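(* Let $\lambda\ge 0$ and $\mu_1\in\mathbb{R}$ be real constants and let $n\ge 2$ be an integer. Then there exists a unique analytic function $h$ on $[0,\infty)$ satisfying $$2r^2h(r)h_{rr}(r)=(n-1)h(r)(h(r)-1)+rh_r(r)\big(rh_r(r)-\lambda r-(n-1)\big),\qquad h(r)>0,\qquad \forall r>0,$$ together with $h(0)=1$ and $h_r(0)=\mu_1$.
   Context: Functions are real-valued; $h_r$ and $h_{rr}$ denote the first and second derivatives of $h$ in $r$. "Analytic on $[0,\infty)$" means real analytic at every point of $[0,\infty)$, including $r=0$, where $h$ is given by a convergent power series in $r$ on some interval $[0,\varepsilon)$, $\varepsilon>0$. *)

theory Defs
  imports "HOL-Analysis.Analysis"
begin

text \<open>
  Real analyticity of \<open>f\<close> on a set \<open>S\<close>, relative to \<open>S\<close>: around every point \<open>c\<close> of \<open>S\<close>, the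
  function is given on the part of a neighbourhood of \<open>c\<close> that lies in \<open>S\<close> by a power series
  in \<open>x - c\<close>. For \<open>S = {0..}\<close> this is the usual two-sided condition at \<open>c > 0\<close> (as the radius
  may be shrunk below \<open>c\<close>), and at \<open>c = 0\<close> it is a power series expansion on \<open>{0..<\<epsilon>}\<close>. Values
  of \<open>f\<close> outside \<open>S\<close> are irrelevant.
\<close>

definition real_analytic_on :: "(real \<Rightarrow> real) \<Rightarrow> real set \<Rightarrow> bool" where
  "real_analytic_on f S \<longleftrightarrow>
     (\<forall>c\<in>S. \<exists>a :: nat \<Rightarrow> real. \<exists>\<epsilon>>0.
        \<forall>x\<in>S. \<bar>x - c\<bar> < \<epsilon> \<longrightarrow> (\<lambda>k. a k * (x - c) ^ k) sums f x)"

text \<open>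
  The first derivative at the endpoint \<open>0\<close> is one-sided; for \<open>r > 0\<close> the operator \<open>deriv\<close> only
  depends on \<open>h\<close> near \<open>r\<close>, hence not on its values outside \<open>{0..}\<close>.
\<close>

definition is_solution :: "real \<Rightarrow> real \<Rightarrow> nat \<Rightarrow> (real \<Rightarrow> real) \<Rightarrow> bool" where
  "is_solution lam \<mu>\<^sub>1 n h \<longleftrightarrow>
     real_analytic_on h {0..} \<and>
     (\<forall>r>0. 2 * r\<^sup>2 * h r * deriv (deriv h) r =
               (real n - 1) * h r * (h r - 1)
               + r * deriv h r * (r * deriv h r - lam * r - (real n - 1))
            \<and> h r > 0) \<and>
     h 0 = 1 \<and>
     (h has_real_derivative \<mu>\<^sub>1) (at 0 within {0..})"

end

theory Submission
  imports Defs "HOL-Complex_Analysis.Cauchy_Integral_Formula"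
begin

text \<open>
  Write \<open>m = n - 1\<close>. At \<open>r = 0\<close> the equation determines the Taylor coefficients recursively from
  \<open>h 0 = 1\<close> and \<open>h\<^sub>r 0 = \<mu>\<^sub>1\<close>, because the linearised operator acts on \<open>r ^ k\<close> as multiplication by
  \<open>(k - 1) (2 k + m)\<close>; a majorant argument gives convergence. This yields local existence, and
  uniqueness by the identity theorem for power series.

  For global existence no separate Cauchy problem has to be solved: at a point \<open>c > 0\<close> the Taylor
  coefficients of an analytic solution satisfy a recursion that bounds the radius of convergence from
  below in terms of bounds for \<open>h\<close>, \<open>h\<^sub>r\<close>, \<open>1 / h\<close> and \<open>1 / c\<close> only. Hence a solution on \<open>[0, R)\<close> for which
  these stay bounded near \<open>R\<close> extends beyond \<open>R\<close>. If \<open>\<mu>\<^sub>1 = 0\<close>, then \<open>h = 1\<close>. Otherwise \<open>h - 1\<close> and \<open>h\<^sub>r\<close>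
  keep the sign of \<open>\<mu>\<^sub>1\<close>, since at a first zero of \<open>h\<^sub>r\<close> the equation gives \<open>h\<^sub>r\<^sub>r\<close> the sign of \<open>h - 1\<close>.
  For \<open>\<mu>\<^sub>1 > 0\<close> the function \<open>r h\<^sub>r / h - (m + 1) / 2 ln r\<close> is nonincreasing, and for \<open>\<mu>\<^sub>1 < 0\<close> the
  function \<open>h - r h\<^sub>r - m / 2 ln h - m / 2 ln r\<close> is; both give the required bounds.
\<close>

section \<open>Real power series\<close>

text \<open>Zeros of a nonzero power series are isolated: by continuity if the constant term is
  nonzero, and by \<open>powser_0_nonzero\<close> if the series vanishes at 0. The hypothesis uses
  \<open>frequently\<close>, so agreement on one side of 0 suffices.\<close>

lemma fps_eq_0_if_frequently_0:
  fixes F :: "real fps"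
  assumes "fps_conv_radius F > 0" "\<exists>\<^sub>F x in at 0. eval_fps F x = 0"
  shows "F = 0"
proof (rule ccontr)
  assume "F \<noteq> 0"
  have isol: "\<forall>\<^sub>F x in at 0. eval_fps F x \<noteq> 0"
  proof (cases "fps_nth F 0 = 0")
    case False
    have "isCont (eval_fps F) 0"
      using assms(1) by (intro continuous_eval_fps) (simp add: zero_ereal_def)
    then have "(eval_fps F \<longlongrightarrow> fps_nth F 0) (at 0)"
      by (simp add: isCont_def eval_fps_at_0)
    then show ?thesis
      using False by (rule tendsto_imp_eventually_ne)
  next
    case True
    obtain k where k: "fps_nth F k \<noteq> 0"
      using \<open>F \<noteq> 0\<close> by (auto simp: fps_eq_iff)
    with True have "k > 0" by (cases k) auto
    obtain r where r: "r > 0" "ereal r < fps_conv_radius F"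
      using assms(1) ereal_dense2[of 0 "fps_conv_radius F"] by (auto simp: zero_ereal_def)
    have sums: "(\<lambda>n. fps_nth F n * (x - 0) ^ n) sums eval_fps F x" if "norm (x - 0) < r" for x
      using sums_eval_fps[of x F] that r
      by (simp add: order.strict_trans[of "ereal \<bar>x\<bar>" "ereal r"])
    have "eval_fps F 0 = 0"
      using True by (simp add: eval_fps_at_0)
    with r(1) sums show ?thesis
      using k \<open>k > 0\<close>
    proof (rule powser_0_nonzero[of r 0 "fps_nth F" "eval_fps F" k])
      fix s :: real assume "s > 0" "\<And>z. z \<in> cball 0 s - {0} \<Longrightarrow> eval_fps F z \<noteq> 0"
      then show ?thesis
        unfolding eventually_at by (intro exI[of _ s]) (auto simp: dist_real_def)
    qed
  qed
  with assms(2) show False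
    by (simp add: frequently_def)
qed

lemma fps_eq_if_frequently_0:
  fixes F G :: "real fps"
  assumes "fps_conv_radius F > 0" "fps_conv_radius G > 0"
    and "\<exists>\<^sub>F x in at 0. eval_fps F x = eval_fps G x"
  shows "F = G"
proof -
  have pos: "min (fps_conv_radius F) (fps_conv_radius G) > 0"
    using assms by simp
  obtain r where r: "r > 0" "ereal r < min (fps_conv_radius F) (fps_conv_radius G)"
    using pos ereal_dense2[OF pos] by (auto simp: zero_ereal_def)
  have "\<forall>\<^sub>F x in at 0. \<bar>x\<bar> < r"
    using r by (auto simp: eventually_at intro!: exI[of _ r])
  with assms(3) have "\<exists>\<^sub>F x in at 0. eval_fps F x = eval_fps G x \<and> \<bar>x\<bar> < r"
    by (rule frequently_eventually_frequently)
  then have "\<exists>\<^sub>F x in at 0. eval_fps (F - G) x = 0"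
  proof (rule frequently_elim1)
    fix x assume x: "eval_fps F x = eval_fps G x \<and> \<bar>x\<bar> < r"
    then have "ereal \<bar>x\<bar> < ereal r" by simp
    then have "ereal \<bar>x\<bar> < fps_conv_radius F" "ereal \<bar>x\<bar> < fps_conv_radius G"
      using r order.strict_trans[of "ereal \<bar>x\<bar>" "ereal r"] by auto
    then show "eval_fps (F - G) x = 0"
      using x by (simp add: eval_fps_diff)
  qed
  moreover have "fps_conv_radius (F - G) > 0"
    using fps_conv_radius_diff[of F G] pos by (rule order.strict_trans2[rotated])
  ultimately have "F - G = 0"
    by (rule fps_eq_0_if_frequently_0[rotated])
  then show ?thesis by simp
qed

lemma frequently_at_if_eventually_at_right:
  fixes a :: real
  assumes "\<forall>\<^sub>F x in at_right a. P x"
  shows "\<exists>\<^sub>F x in at a. P x"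
proof -
  have "\<exists>\<^sub>F x in at_right a. P x"
    using assms by (simp add: eventually_frequently)
  then show ?thesis
    by (auto simp: frequently_def eventually_at_split)
qed

lemma frequently_at_if_eventually_at_left:
  fixes a :: real
  assumes "\<forall>\<^sub>F x in at_left a. P x"
  shows "\<exists>\<^sub>F x in at a. P x"
proof -
  have "\<exists>\<^sub>F x in at_left a. P x"
    using assms by (simp add: eventually_frequently)
  then show ?thesis
    by (auto simp: frequently_def eventually_at_split)
qed

text \<open>Bridges the library notion of an expansion and the pointwise \<open>sums\<close>
  condition in \<open>real_analytic_on\<close>.\<close>

lemma has_fps_expansion_iff_sums:
  fixes f :: "real \<Rightarrow> real"
  shows "f has_fps_expansion F \<longleftrightarrow>
    (\<exists>e>0. \<forall>x. \<bar>x\<bar> < e \<longrightarrow> (\<lambda>k. fps_nth F k * x ^ k) sums f x)"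
proof
  assume F: "f has_fps_expansion F"
  then obtain e1 where e1: "e1 > 0" "\<And>x. \<bar>x\<bar> < e1 \<Longrightarrow> eval_fps F x = f x"
    by (auto simp: has_fps_expansion_def eventually_nhds_metric dist_real_def)
  obtain e2 where e2: "e2 > 0" "ereal e2 < fps_conv_radius F"
    using F ereal_dense2[of 0 "fps_conv_radius F"]
    by (auto simp: zero_ereal_def has_fps_expansion_def)
  show "\<exists>e>0. \<forall>x. \<bar>x\<bar> < e \<longrightarrow> (\<lambda>k. fps_nth F k * x ^ k) sums f x"
  proof (intro exI[of _ "min e1 e2"] conjI allI impI)
    fix x assume x: "\<bar>x\<bar> < min e1 e2"
    then have "ereal (norm x) < fps_conv_radius F"
      using e2 by (auto intro: order.strict_trans[of _ "ereal e2"])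
    from sums_eval_fps[OF this] show "(\<lambda>k. fps_nth F k * x ^ k) sums f x"
      using e1(2)[of x] x by simp
  qed (use e1 e2 in auto)
next
  assume "\<exists>e>0. \<forall>x. \<bar>x\<bar> < e \<longrightarrow> (\<lambda>k. fps_nth F k * x ^ k) sums f x"
  then obtain e where e: "e > 0" "\<And>x. \<bar>x\<bar> < e \<Longrightarrow> (\<lambda>k. fps_nth F k * x ^ k) sums f x"
    by auto
  have "ereal (norm (e / 2)) \<le> fps_conv_radius F"
    unfolding fps_conv_radius_def
    using e(1) by (intro conv_radius_geI sums_summable[OF e(2)]) auto
  then have "fps_conv_radius F > 0"
    using e(1) by (auto simp: zero_ereal_def intro: order.strict_trans2[of _ "ereal (e / 2)"])
  moreover have "\<forall>\<^sub>F z in nhds 0. eval_fps F z = f z"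
    unfolding eventually_nhds_metric dist_real_def
    using e by (auto simp: eval_fps_def sums_iff intro!: exI[of _ e])
  ultimately show "f has_fps_expansion F"
    by (simp add: has_fps_expansion_def)
qed

text \<open>Read with complex coefficients, the series has the same radius and a holomorphic sum.
  Its Taylor series about the real point \<open>s\<close> yields the real expansion by taking real
  parts.\<close>

lemma eval_fps_recenter:
  fixes F :: "real fps"
  assumes "ereal \<bar>s\<bar> < fps_conv_radius F"
  shows "\<exists>G. (\<lambda>t. eval_fps F (s + t)) has_fps_expansion G"
proof -
  define Fc where "Fc = Abs_fps (\<lambda>k. complex_of_real (fps_nth F k))"
  have rad: "fps_conv_radius Fc = fps_conv_radius F"
    by (subst (1 2) fps_conv_radius_norm[symmetric]) (simp add: Fc_def)
  have eval: "eval_fps Fc (of_real x) = of_real (eval_fps F x)" if "ereal \<bar>x\<bar> < fps_conv_radius F" for x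
  proof -
    have "(\<lambda>n. of_real (fps_nth F n * x ^ n)) sums complex_of_real (eval_fps F x)"
      using sums_eval_fps[of x F] that by (subst sums_of_real_iff) auto
    then show ?thesis
      by (simp add: eval_fps_def Fc_def sums_iff)
  qed
  obtain r where r: "\<bar>s\<bar> < r" "ereal r < fps_conv_radius F"
    using ereal_dense2[OF assms] by auto
  define e where "e = r - \<bar>s\<bar>"
  have "ball (complex_of_real s) e \<subseteq> eball 0 (fps_conv_radius Fc)"
  proof
    fix w :: complex assume "w \<in> ball (of_real s) e"
    then have "cmod w < r"
      using norm_triangle_ineq2[of w "of_real s"] by (simp add: dist_norm e_def norm_minus_commute)
    then show "w \<in> eball 0 (fps_conv_radius Fc)"
      using r by (auto simp: rad intro: order.strict_trans[of _ "ereal r"])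
  qed
  then have hol: "eval_fps Fc holomorphic_on ball (of_real s) e"
    by (rule holomorphic_on_eval_fps)
  define G where "G = Abs_fps (\<lambda>n. Re ((deriv ^^ n) (eval_fps Fc) (of_real s) / fact n))"
  have "(\<lambda>k. fps_nth G k * t ^ k) sums eval_fps F (s + t)" if "\<bar>t\<bar> < e" for t
  proof -
    have "of_real (s + t) \<in> ball (complex_of_real s) e"
      using that by (simp add: dist_norm)
    have Re: "Re (z * complex_of_real u) = Re z * u" for z u
      by simp
    from sums_Re[OF holomorphic_power_series[OF hol \<open>of_real (s + t) \<in> ball (complex_of_real s) e\<close>]]
    have "(\<lambda>k. fps_nth G k * t ^ k) sums Re (eval_fps Fc (of_real (s + t)))"
      by (simp only: G_def fps_nth_Abs_fps of_real_add add_diff_cancel_left' of_real_power[symmetric] Re)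
    moreover have "ereal \<bar>s + t\<bar> < fps_conv_radius F"
      using that r by (auto simp: e_def intro: order.strict_trans[of _ "ereal r"])
    ultimately show ?thesis
      using eval[of "s + t"] by simp
  qed
  moreover have "e > 0" using r by (simp add: e_def)
  ultimately show ?thesis
    using has_fps_expansion_iff_sums by blast
qed

text \<open>Bundles convergence with the value, so that polynomial expressions are evaluated by
  composing rules, without separate radius conditions.\<close>

definition evaluates :: "real fps \<Rightarrow> real \<Rightarrow> real \<Rightarrow> bool" where
  "evaluates F s a \<longleftrightarrow> ereal \<bar>s\<bar> < fps_conv_radius F \<and> eval_fps F s = a"

lemma evaluates_const: "evaluates (fps_const a) s a"
  by (simp add: evaluates_def)

lemma evaluates_1: "evaluates 1 s 1"
  by (simp add: evaluates_def)

lemma evaluates_X: "evaluates fps_X s s"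
  by (simp add: evaluates_def)

lemma evaluates_add:
  assumes "evaluates F s a" "evaluates G s b"
  shows "evaluates (F + G) s (a + b)"
  using assms order.strict_trans2[OF _ fps_conv_radius_add[of F G], of "ereal \<bar>s\<bar>"]
  by (simp add: evaluates_def eval_fps_add)

lemma evaluates_diff:
  assumes "evaluates F s a" "evaluates G s b"
  shows "evaluates (F - G) s (a - b)"
  using assms order.strict_trans2[OF _ fps_conv_radius_diff[of F G], of "ereal \<bar>s\<bar>"]
  by (simp add: evaluates_def eval_fps_diff)

lemma evaluates_mult:
  assumes "evaluates F s a" "evaluates G s b"
  shows "evaluates (F * G) s (a * b)"
  using assms order.strict_trans2[OF _ fps_conv_radius_mult[of F G], of "ereal \<bar>s\<bar>"]
  by (simp add: evaluates_def eval_fps_mult)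

lemmas evaluates_intros =
  evaluates_const evaluates_1 evaluates_X evaluates_add evaluates_diff evaluates_mult

lemma less_fps_conv_radius_deriv:
  fixes F :: "real fps"
  shows "x < fps_conv_radius F \<Longrightarrow> x < fps_conv_radius (fps_deriv F)"
  using fps_conv_radius_deriv order.strict_trans2 by blast

text \<open>The conclusion holds near \<open>r\<close>, not only at \<open>r\<close>, so that the
  lemma can be applied again to the derivative.\<close>

lemma eventually_deriv_eval_fps:
  fixes F :: "real fps"
  assumes "\<forall>\<^sub>F x in nhds r. f x = eval_fps F (x - c)" "ereal \<bar>r - c\<bar> < fps_conv_radius F"
  shows "\<forall>\<^sub>F x in nhds r. (f has_real_derivative eval_fps (fps_deriv F) (x - c)) (at x)"
proof -
  have "open {x. ereal \<bar>x - c\<bar> < fps_conv_radius F}"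
  proof -
    have "{x. ereal \<bar>x - c\<bar> < fps_conv_radius F} = eball c (fps_conv_radius F)"
      by (auto simp: dist_real_def abs_minus_commute)
    then show ?thesis by simp
  qed
  then have "\<forall>\<^sub>F x in nhds r. ereal \<bar>x - c\<bar> < fps_conv_radius F"
    using assms(2) by (auto simp: eventually_nhds)
  moreover have "\<forall>\<^sub>F x in nhds r. \<forall>\<^sub>F y in nhds x. f y = eval_fps F (y - c)"
    using assms(1) by (simp add: eventually_eventually)
  ultimately show ?thesis
  proof eventually_elim
    case (elim x)
    have "((\<lambda>x. eval_fps F (x - c)) has_real_derivative eval_fps (fps_deriv F) (x - c) * 1) (at x)"
      by (rule DERIV_chain2[OF has_field_derivative_eval_fps])
        (use elim in \<open>auto intro!: derivative_eq_intros\<close>)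
    then show ?case
      using DERIV_cong_ev[OF refl elim(2) refl] by simp
  qed
qed

definition power_series_at :: "(real \<Rightarrow> real) \<Rightarrow> real \<Rightarrow> real fps \<Rightarrow> bool" where
  "power_series_at f c F \<longleftrightarrow>
     fps_conv_radius F > 0 \<and> (\<forall>\<^sub>F x in nhds c. f x = eval_fps F (x - c))"

lemma power_series_at_iff_has_fps_expansion:
  "power_series_at f c F \<longleftrightarrow> (\<lambda>s. f (c + s)) has_fps_expansion F"
proof -
  have "nhds 0 = filtermap (\<lambda>x. x - c) (nhds c)"
    by (simp add: filtermap_nhds_shift)
  then show ?thesis
    by (simp add: power_series_at_def has_fps_expansion_def eventually_filtermap eq_commute[of "f _"])
qed

lemma power_series_at_cong:
  assumes "power_series_at f c F" "\<forall>\<^sub>F x in nhds c. f x = g x"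
  shows "power_series_at g c F"
proof -
  have "\<forall>\<^sub>F x in nhds c. f x = eval_fps F (x - c)"
    using assms(1) by (simp add: power_series_at_def)
  then have "\<forall>\<^sub>F x in nhds c. g x = eval_fps F (x - c)"
    using assms(2) by eventually_elim simp
  then show ?thesis
    using assms(1) by (simp add: power_series_at_def)
qed

lemma power_series_at_deriv:
  assumes "power_series_at f c F"
  shows "power_series_at (deriv f) c (fps_deriv F)" and "(f has_real_derivative deriv f c) (at c)"
    and "f c = fps_nth F 0"
proof -
  have rad: "ereal \<bar>c - c\<bar> < fps_conv_radius F" and ev: "\<forall>\<^sub>F x in nhds c. f x = eval_fps F (x - c)"
    using assms by (simp_all add: power_series_at_def zero_ereal_def)
  note D = eventually_deriv_eval_fps[OF ev rad]
  then have "\<forall>\<^sub>F x in nhds c. deriv f x = eval_fps (fps_deriv F) (x - c)"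
    by eventually_elim (rule DERIV_imp_deriv)
  then show "power_series_at (deriv f) c (fps_deriv F)"
    using assms less_fps_conv_radius_deriv by (simp add: power_series_at_def)
  show "(f has_real_derivative deriv f c) (at c)"
    using eventually_nhds_x_imp_x[OF D] DERIV_imp_deriv[OF eventually_nhds_x_imp_x[OF D]] by simp
  show "f c = fps_nth F 0"
    using eventually_nhds_x_imp_x[OF ev] by (simp add: eval_fps_at_0)
qed

lemma power_series_at_recenter:
  assumes "\<forall>\<^sub>F x in nhds d. f x = eval_fps F (x - c)" "ereal \<bar>d - c\<bar> < fps_conv_radius F"
  shows "\<exists>G. power_series_at f d G"
proof -
  obtain G where "(\<lambda>t. eval_fps F (d - c + t)) has_fps_expansion G"
    using eval_fps_recenter[OF assms(2)] by blast
  then have "power_series_at (\<lambda>x. eval_fps F (x - c)) d G"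
    by (simp add: power_series_at_iff_has_fps_expansion add_diff_eq diff_add_eq)
  then have "power_series_at f d G"
    by (rule power_series_at_cong) (use assms(1) in \<open>simp add: eq_commute[of "eval_fps F _"]\<close>)
  then show ?thesis ..
qed

section \<open>Majorants\<close>

lemma fps_conv_radius_ge_if_geometric:
  fixes F :: "real fps"
  assumes "B > 0" "\<And>k. \<bar>fps_nth F k\<bar> \<le> M * B ^ k"
  shows "fps_conv_radius F \<ge> ereal (1 / B)"
  unfolding fps_conv_radius_def
proof (rule conv_radius_geI_ex')
  fix r assume r: "0 < r" "ereal r < ereal (1 / B)"
  then have "B * r < 1" "B * r \<ge> 0"
    using assms(1) by (auto simp: field_simps)
  then have "summable (\<lambda>k. M * (B * r) ^ k)"
    by (intro summable_mult summable_geometric) simp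
  then show "summable (\<lambda>k. fps_nth F k * of_real r ^ k)"
  proof (rule summable_comparison_test'[where N = 0])
    fix k
    have "\<bar>fps_nth F k\<bar> * r ^ k \<le> (M * B ^ k) * r ^ k"
      using assms r by (intro mult_right_mono) auto
    then show "norm (fps_nth F k * of_real r ^ k) \<le> M * (B * r) ^ k"
      using r by (simp add: abs_mult power_mult_distrib power_abs mult.assoc)
  qed
qed

text \<open>Telescoping: 1 / (k + 2)^2 is at most 1 / (k + 1) - 1 / (k + 2).\<close>

lemma sum_inverse_squares_le: "(\<Sum>i\<le>k. 1 / (real i + 1)\<^sup>2) \<le> 2 - 1 / (real k + 1)"
proof (induction k)
  case (Suc k)
  have "1 / (real k + 2)\<^sup>2 \<le> 1 / (real k + 1) - 1 / (real k + 2)"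
    by (simp add: divide_simps power2_eq_square)
  with Suc show ?case
    by (simp add: add_ac)
qed simp

text \<open>With p = i + 1 and q = k - i + 1, the inequality (p + q)^2 \<le> 2 (p^2 + q^2) splits
  each product into two inverse squares. Each of the two resulting sums is at most 2, hence 2 * (2 +
  2) = 8.\<close>

lemma sum_convolution_inverse_squares_le:
  "(\<Sum>i\<le>k. 1 / (real i + 1)\<^sup>2 * (1 / (real (k - i) + 1)\<^sup>2)) \<le> 8 / (real k + 1)\<^sup>2"
proof -
  have "(\<Sum>i\<le>k. 1 / (real i + 1)\<^sup>2 * (1 / (real (k - i) + 1)\<^sup>2))
      \<le> (\<Sum>i\<le>k. 2 / (real k + 2)\<^sup>2 * (1 / (real i + 1)\<^sup>2 + 1 / (real (k - i) + 1)\<^sup>2))"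
  proof (rule sum_mono)
    fix i assume "i \<in> {..k}"
    define p q where "p = real i + 1" and "q = real (k - i) + 1"
    have pos: "p > 0" "q > 0" by (auto simp: p_def q_def)
    have k: "real k + 2 = p + q"
      using \<open>i \<in> {..k}\<close> by (auto simp: p_def q_def)
    have "(p + q)\<^sup>2 \<le> 2 * (p\<^sup>2 + q\<^sup>2)"
      using sum_squares_bound[of p q] by (simp add: power2_sum)
    then have "1 / p\<^sup>2 * (1 / q\<^sup>2) \<le> 2 / (p + q)\<^sup>2 * (1 / p\<^sup>2 + 1 / q\<^sup>2)"
      using pos by (simp add: divide_simps)
    then show "1 / (real i + 1)\<^sup>2 * (1 / (real (k - i) + 1)\<^sup>2)
        \<le> 2 / (real k + 2)\<^sup>2 * (1 / (real i + 1)\<^sup>2 + 1 / (real (k - i) + 1)\<^sup>2)"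
      unfolding k by (simp add: p_def q_def)
  qed
  also have "\<dots> = 2 / (real k + 2)\<^sup>2 * ((\<Sum>i\<le>k. 1 / (real i + 1)\<^sup>2) + (\<Sum>i\<le>k. 1 / (real (k - i) + 1)\<^sup>2))"
    by (simp only: sum_distrib_left[symmetric] sum.distrib)
  also have "(\<Sum>i\<le>k. 1 / (real (k - i) + 1)\<^sup>2) = (\<Sum>i\<le>k. 1 / (real i + 1)\<^sup>2)"
    using sum.nat_diff_reindex[of "\<lambda>i. 1 / (real i + 1)\<^sup>2" "Suc k"] by (simp add: lessThan_Suc_atMost)
  also have "2 / (real k + 2)\<^sup>2 * ((\<Sum>i\<le>k. 1 / (real i + 1)\<^sup>2) + (\<Sum>i\<le>k. 1 / (real i + 1)\<^sup>2))
      \<le> 2 / (real k + 1)\<^sup>2 * (2 + 2)"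
  proof (rule mult_mono)
    have *: "(\<Sum>i\<le>k. 1 / (real i + 1)\<^sup>2) \<le> 2"
      using sum_inverse_squares_le[of k] by (rule order_trans) simp
    then show "(\<Sum>i\<le>k. 1 / (real i + 1)\<^sup>2) + (\<Sum>i\<le>k. 1 / (real i + 1)\<^sup>2) \<le> 2 + 2"
      by linarith
    show "2 / (real k + 2)\<^sup>2 \<le> 2 / (real k + 1)\<^sup>2"
      by (intro divide_left_mono power_mono) auto
  qed (auto intro!: add_nonneg_nonneg sum_nonneg)
  finally show ?thesis by simp
qed

text \<open>
  The factor \<open>1 / (k + 1)\<^sup>2\<close> makes the class of majorants closed under Cauchy products, up to a
  constant.
\<close>

definition majorized :: "real \<Rightarrow> real \<Rightarrow> nat \<Rightarrow> real fps \<Rightarrow> bool" where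
  "majorized M B K F \<longleftrightarrow> (\<forall>k\<le>K. \<bar>fps_nth F k\<bar> \<le> M * (B ^ k / (real k + 1)\<^sup>2))"

lemma majorized_mono:
  assumes "majorized M B K F" "M \<le> M'" "B \<ge> 0"
  shows "majorized M' B K F"
  unfolding majorized_def
proof (intro allI impI)
  fix k assume "k \<le> K"
  then have "\<bar>fps_nth F k\<bar> \<le> M * (B ^ k / (real k + 1)\<^sup>2)"
    using assms by (simp only: majorized_def)
  also have "\<dots> \<le> M' * (B ^ k / (real k + 1)\<^sup>2)"
    using assms by (intro mult_right_mono) auto
  finally show "\<bar>fps_nth F k\<bar> \<le> M' * (B ^ k / (real k + 1)\<^sup>2)" .
qed

lemma majorized_add:
  assumes "majorized M B K F" "majorized M' B K G"
  shows "majorized (M + M') B K (F + G)"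
  unfolding majorized_def
proof (intro allI impI)
  fix k assume "k \<le> K"
  then have "\<bar>fps_nth F k\<bar> \<le> M * (B ^ k / (real k + 1)\<^sup>2)" "\<bar>fps_nth G k\<bar> \<le> M' * (B ^ k / (real k + 1)\<^sup>2)"
    using assms by (simp_all only: majorized_def)
  then show "\<bar>fps_nth (F + G) k\<bar> \<le> (M + M') * (B ^ k / (real k + 1)\<^sup>2)"
    unfolding distrib_right fps_add_nth by linarith
qed

lemma majorized_cmult:
  assumes "majorized M B K F"
  shows "majorized (\<bar>c\<bar> * M) B K (fps_const c * F)"
  using assms
  by (auto simp: majorized_def abs_mult mult.assoc simp del: times_divide_eq_right intro!: mult_left_mono)

lemma majorized_uminus: "majorized M B K F \<Longrightarrow> majorized M B K (- F)"
  by (simp add: majorized_def)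

lemma majorized_diff:
  "majorized M B K F \<Longrightarrow> majorized M' B K G \<Longrightarrow> majorized (M + M') B K (F - G)"
  using majorized_add[of M B K F M' "- G"] by (simp add: majorized_uminus)

text \<open>The factor 8 is the constant of
  \<open>sum_convolution_inverse_squares_le\<close>.\<close>

lemma majorized_mult:
  assumes "majorized M B K F" "majorized M' B K G" "B \<ge> 0" "M \<ge> 0" "M' \<ge> 0"
  shows "majorized (8 * M * M') B K (F * G)"
  unfolding majorized_def
proof (intro allI impI)
  fix k assume k: "k \<le> K"
  have "\<bar>fps_nth (F * G) k\<bar> \<le> (\<Sum>i\<le>k. \<bar>fps_nth F i\<bar> * \<bar>fps_nth G (k - i)\<bar>)"
    unfolding fps_mult_nth atLeast0AtMost by (rule order_trans[OF sum_abs]) (simp add: abs_mult)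
  also have "\<dots> \<le> (\<Sum>i\<le>k. (M * M' * B ^ k) * (1 / (real i + 1)\<^sup>2 * (1 / (real (k - i) + 1)\<^sup>2)))"
  proof (rule sum_mono)
    fix i assume i: "i \<in> {..k}"
    then have B: "B ^ k = B ^ i * B ^ (k - i)"
      by (simp flip: power_add)
    have "\<bar>fps_nth F i\<bar> * \<bar>fps_nth G (k - i)\<bar>
        \<le> (M * (B ^ i / (real i + 1)\<^sup>2)) * (M' * (B ^ (k - i) / (real (k - i) + 1)\<^sup>2))"
      using assms(3-5) i k by (intro mult_mono assms(1,2)[unfolded majorized_def, rule_format]) auto
    then show "\<bar>fps_nth F i\<bar> * \<bar>fps_nth G (k - i)\<bar>
        \<le> (M * M' * B ^ k) * (1 / (real i + 1)\<^sup>2 * (1 / (real (k - i) + 1)\<^sup>2))"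
      by (simp add: B mult_ac)
  qed
  also have "\<dots> = (M * M' * B ^ k) * (\<Sum>i\<le>k. 1 / (real i + 1)\<^sup>2 * (1 / (real (k - i) + 1)\<^sup>2))"
    by (rule sum_distrib_left[symmetric])
  also have "\<dots> \<le> (M * M' * B ^ k) * (8 / (real k + 1)\<^sup>2)"
    using assms by (intro mult_left_mono sum_convolution_inverse_squares_le) auto
  finally show "\<bar>fps_nth (F * G) k\<bar> \<le> 8 * M * M' * (B ^ k / (real k + 1)\<^sup>2)"
    by (simp add: mult_ac)
qed

text \<open>Gains one coefficient from a bound on the derivative. Passing from index j to j + 1
  changes the weight by ((j + 2) / (j + 1))^2 \<le> 4, which the factor 4 in the hypothesis pays
  for.\<close>

lemma majorized_deriv:
  assumes "majorized M B K F" "majorized N B K (fps_deriv F)" "4 * N \<le> M * B" "B \<ge> 0"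
  shows "majorized M B (Suc K) F"
  unfolding majorized_def
proof (intro allI impI)
  fix k assume "k \<le> Suc K"
  show "\<bar>fps_nth F k\<bar> \<le> M * (B ^ k / (real k + 1)\<^sup>2)"
  proof (cases k)
    case 0
    then show ?thesis
      using assms(1) unfolding majorized_def by auto
  next
    case (Suc j)
    define w where "w = B ^ j / (real j + 1)\<^sup>2"
    have "w \<ge> 0" using assms(4) by (simp add: w_def)
    have "j \<le> K" using Suc \<open>k \<le> Suc K\<close> by simp
    then have "(real j + 1) * \<bar>fps_nth F (Suc j)\<bar> \<le> N * w"
      using assms(2) unfolding majorized_def w_def by (auto simp: abs_mult add.commute)
    moreover have "\<bar>fps_nth F (Suc j)\<bar> \<le> (real j + 1) * \<bar>fps_nth F (Suc j)\<bar>"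
      by (simp add: distrib_right)
    moreover have "4 * N * w \<le> M * B * w"
      using assms(3) \<open>w \<ge> 0\<close> by (rule mult_right_mono)
    ultimately have "4 * \<bar>fps_nth F (Suc j)\<bar> \<le> M * B * w"
      by linarith
    moreover have "(real j + 2)\<^sup>2 \<le> 4 * (real j + 1)\<^sup>2"
      by (simp add: power2_eq_square algebra_simps)
    then have "(real j + 2)\<^sup>2 * \<bar>fps_nth F (Suc j)\<bar> \<le> (real j + 1)\<^sup>2 * (4 * \<bar>fps_nth F (Suc j)\<bar>)"
      using mult_right_mono[of _ _ "\<bar>fps_nth F (Suc j)\<bar>"] by fastforce
    moreover have "(real j + 1)\<^sup>2 * (4 * \<bar>fps_nth F (Suc j)\<bar>) \<le> (real j + 1)\<^sup>2 * (M * B * w)"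
      using calculation(1) by (rule mult_left_mono) simp
    ultimately have "(real j + 2)\<^sup>2 * \<bar>fps_nth F (Suc j)\<bar> \<le> (real j + 1)\<^sup>2 * (M * B * w)"
      by linarith
    also have "\<dots> = M * B ^ Suc j"
      by (simp add: w_def)
    finally show ?thesis
      by (simp add: Suc field_simps)
  qed
qed

lemma majorized_mult3:
  assumes "majorized M B K F" "majorized M B K G" "majorized M B K H" "B \<ge> 0" "M \<ge> 0"
  shows "majorized (64 * M ^ 3) B K (F * G * H)"
proof -
  have "majorized (8 * (8 * M * M) * M) B K (F * G * H)"
    using assms by (intro majorized_mult) auto
  then show ?thesis
    by (simp add: power3_eq_cube mult_ac)
qed

lemma majorized_1: "B \<ge> 0 \<Longrightarrow> majorized 1 B K 1"
  by (auto simp: majorized_def)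

lemma majorized_0_iff: "majorized M B 0 F \<longleftrightarrow> \<bar>fps_nth F 0\<bar> \<le> M"
  by (simp add: majorized_def)

lemma fps_conv_radius_ge_if_majorized:
  assumes "\<And>K. majorized M B K F" "B > 0" "M \<ge> 0"
  shows "fps_conv_radius F \<ge> ereal (1 / B)"
proof (rule fps_conv_radius_ge_if_geometric)
  fix k
  have "\<bar>fps_nth F k\<bar> \<le> M * (B ^ k / (real k + 1)\<^sup>2)"
    using assms(1)[of k] by (simp add: majorized_def)
  also have "\<dots> \<le> M * (B ^ k / 1)"
    using assms by (intro mult_left_mono frac_le) (auto simp: one_le_power)
  finally show "\<bar>fps_nth F k\<bar> \<le> M * B ^ k" by simp
qed fact

section \<open>The equation on power series\<close>

locale soliton_ode =
  fixes lam m :: real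
  assumes lam_nonneg: "lam \<ge> 0" and m_ge_1: "m \<ge> 1"
begin

definition solves_at :: "(real \<Rightarrow> real) \<Rightarrow> real \<Rightarrow> bool" where
  "solves_at f r \<longleftrightarrow> 2 * r\<^sup>2 * f r * deriv (deriv f) r =
     m * f r * (f r - 1) + r * deriv f r * (r * deriv f r - lam * r - m)"

text \<open>Left side minus right side of the equation with r = c + X. Squares are products and
  constants are \<open>fps_const\<close>, so that \<open>evaluates_intros\<close> applies
  syntactically.\<close>

definition residual :: "real \<Rightarrow> real fps \<Rightarrow> real fps" where
  "residual c F = (let R = fps_const c + fps_X in
     fps_const 2 * (R * R) * F * fps_deriv (fps_deriv F) - (fps_const m * F * (F - 1)
       + R * fps_deriv F * (R * fps_deriv F - fps_const lam * R - fps_const m)))"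

lemma evaluates_residual:
  fixes c s :: real
  assumes "ereal \<bar>s\<bar> < fps_conv_radius F"
  defines "a \<equiv> eval_fps F s" and "b \<equiv> eval_fps (fps_deriv F) s"
    and "d \<equiv> eval_fps (fps_deriv (fps_deriv F)) s" and "r \<equiv> c + s"
  shows "evaluates (residual c F) s
    (2 * (r * r) * a * d - (m * a * (a - 1) + r * b * (r * b - lam * r - m)))"
proof -
  have "evaluates F s a" "evaluates (fps_deriv F) s b" "evaluates (fps_deriv (fps_deriv F)) s d"
    using assms by (auto simp: evaluates_def intro!: less_fps_conv_radius_deriv)
  then show ?thesis
    unfolding residual_def Let_def r_def by (intro evaluates_intros)
qed

text \<open>Reduces the equation at a point to a value of one formal series. Once
  \<open>residual c F\<close> vanishes, the equation holds at every point of the disc of convergence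
  near which \<open>F\<close> represents \<open>f\<close>.\<close>

lemma solves_at_iff_residual:
  assumes "\<forall>\<^sub>F x in nhds r. f x = eval_fps F (x - c)" "ereal \<bar>r - c\<bar> < fps_conv_radius F"
  shows "solves_at f r \<longleftrightarrow> eval_fps (residual c F) (r - c) = 0"
proof -
  have D1: "\<forall>\<^sub>F x in nhds r. deriv f x = eval_fps (fps_deriv F) (x - c)"
    using eventually_deriv_eval_fps[OF assms] by eventually_elim (rule DERIV_imp_deriv)
  have D2: "\<forall>\<^sub>F x in nhds r. deriv (deriv f) x = eval_fps (fps_deriv (fps_deriv F)) (x - c)"
    using eventually_deriv_eval_fps[OF D1 less_fps_conv_radius_deriv[OF assms(2)]]
    by eventually_elim (rule DERIV_imp_deriv)
  have "f r = eval_fps F (r - c)" "deriv f r = eval_fps (fps_deriv F) (r - c)"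
    "deriv (deriv f) r = eval_fps (fps_deriv (fps_deriv F)) (r - c)"
    using assms(1) D1 D2 by (auto dest: eventually_nhds_x_imp_x)
  with evaluates_residual[OF assms(2), of c] show ?thesis
    by (simp add: evaluates_def solves_at_def power2_eq_square)
qed

lemma less_fps_conv_radius_residual:
  assumes "ereal \<bar>s\<bar> < fps_conv_radius F"
  shows "ereal \<bar>s\<bar> < fps_conv_radius (residual c F)"
  using evaluates_residual[OF assms, of c] by (simp add: evaluates_def)

text \<open>
  At a regular point the expansion is two-sided, but at the origin only one side is available;
  validity of the equation on a right neighbourhood covers both.
\<close>

lemma residual_eq_0:
  assumes "fps_conv_radius F > 0"
    and "\<forall>\<^sub>F r in at_right c. f r = eval_fps F (r - c)"
    and "\<forall>\<^sub>F r in at_right c. solves_at f r"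
  shows "residual c F = 0"
proof (rule fps_eq_if_frequently_0)
  obtain e where e: "e > 0" "ereal e < fps_conv_radius F"
    using assms(1) ereal_dense2[of 0 "fps_conv_radius F"] by (auto simp: zero_ereal_def)
  have "ereal \<bar>e\<bar> < fps_conv_radius (residual c F)"
    using e by (intro less_fps_conv_radius_residual) simp
  moreover have "ereal \<bar>e\<bar> > 0" using e by simp
  ultimately show "fps_conv_radius (residual c F) > 0"
    by (rule order.strict_trans[rotated])
  obtain b where b: "b > c" "\<And>r. c < r \<Longrightarrow> r < b \<Longrightarrow> f r = eval_fps F (r - c) \<and> solves_at f r"
    using eventually_conj[OF assms(2,3)] by (auto simp: eventually_at_right[of c "c + 1"])
  have "eval_fps (residual c F) x = 0" if x: "0 < x" "x < min e (b - c)" for x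
  proof -
    have "\<forall>\<^sub>F r in nhds (c + x). r \<in> {c<..<b}"
      using x by (intro eventually_nhds_in_open) auto
    then have "\<forall>\<^sub>F r in nhds (c + x). f r = eval_fps F (r - c)"
      by eventually_elim (use b in auto)
    moreover have "ereal \<bar>c + x - c\<bar> < fps_conv_radius F"
      using x e by (auto intro: order.strict_trans[of _ "ereal e"])
    ultimately show ?thesis
      using solves_at_iff_residual[of f F c "c + x"] b(2)[of "c + x"] x by simp
  qed
  then have "\<forall>\<^sub>F x in at_right 0. eval_fps (residual c F) x = eval_fps 0 x"
    using e b(1) by (auto simp: eventually_at_right[of 0 1] intro!: exI[of _ "min e (b - c)"])
  then show "\<exists>\<^sub>F x in at 0. eval_fps (residual c F) x = eval_fps 0 x"
    by (rule frequently_at_if_eventually_at_right)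
qed simp

section \<open>The expansion at the origin\<close>

text \<open>Weight of the product of coefficients \<open>i\<close> and \<open>j\<close> in the
  quadratic part of the equation, with sign reversed: \<open>m\<close> comes from h^2, i j from (r
  h_r)^2, and 2 j (j - 1) from 2 r^2 h h_rr.\<close>

definition kernel :: "nat \<Rightarrow> nat \<Rightarrow> real" where
  "kernel i j = m + real i * real j - 2 * real j * (real j - 1)"

text \<open>The k-th coefficient of the equation solved for its top unknown. At k = 1 the factor
  \<open>real k - 1\<close> vanishes, which is why \<open>mu\<close> is a free parameter.\<close>

fun origin_coeff :: "real \<Rightarrow> nat \<Rightarrow> real" where
  "origin_coeff mu k = (if k = 0 then 1 else if k = 1 then mu else
     ((\<Sum>i\<in>{1..<k}. kernel i (k - i) * origin_coeff mu i * origin_coeff mu (k - i))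
       - lam * (real k - 1) * origin_coeff mu (k - 1)) / ((real k - 1) * (2 * real k + m)))"

declare origin_coeff.simps [simp del]

lemma origin_coeff_0 [simp]: "origin_coeff mu 0 = 1"
  by (subst origin_coeff.simps) (rule if_P[OF refl])

lemma origin_coeff_1 [simp]: "origin_coeff mu (Suc 0) = mu"
  by (subst origin_coeff.simps) (simp only: One_nat_def if_True if_False refl nat.simps)

lemma origin_coeff_ge_2:
  assumes "k \<ge> 2"
  shows "(real k - 1) * (2 * real k + m) * origin_coeff mu k =
    (\<Sum>i\<in>{1..<k}. kernel i (k - i) * origin_coeff mu i * origin_coeff mu (k - i))
     - lam * (real k - 1) * origin_coeff mu (k - 1)"
proof -
  have "k \<noteq> 0" "k \<noteq> 1" "(real k - 1) * (2 * real k + m) \<noteq> 0"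
    using assms m_ge_1 by auto
  then show ?thesis
    by (subst origin_coeff.simps[of mu k])
      (simp only: if_False times_divide_eq_right nonzero_mult_div_cancel_left not_False_eq_True)
qed

text \<open>At the origin the equation involves only F, \<open>T\<close> = X F' and \<open>E\<close>
  = X^2 F'', whose coefficients are those of F multiplied by k and k (k - 1). Every product thus
  becomes a convolution weighted by \<open>kernel\<close>.\<close>

lemma residual_0_nth:
  fixes F :: "real fps"
  defines "a \<equiv> fps_nth F"
  assumes "a 0 = 1"
  shows "fps_nth (residual 0 F) k = (if k = 0 then 0 else
    (real k - 1) * (2 * real k + m) * a k
    - (\<Sum>i\<in>{1..<k}. kernel i (k - i) * a i * a (k - i)) + lam * (real k - 1) * a (k - 1))"
proof -
  define E where "E = Abs_fps (\<lambda>k. real k * (real k - 1) * a k)"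
  define T where "T = fps_XD F"
  have T: "T = fps_X * fps_deriv F"
    by (simp add: T_def fps_XD_def)
  have E: "E = fps_X * (fps_X * fps_deriv (fps_deriv F))"
  proof (rule fps_ext)
    fix k show "fps_nth E k = fps_nth (fps_X * (fps_X * fps_deriv (fps_deriv F))) k"
      by (cases k; cases "k - 1") (auto simp: E_def a_def algebra_simps of_nat_Suc)
  qed
  have res: "residual 0 F = (fps_const 2 * (F * E) - fps_const m * (F * F) - T * T)
      + (fps_const m * F + fps_const lam * (fps_X * T) + fps_const m * T)"
    unfolding residual_def Let_def T E by (simp add: algebra_simps)
  have "fps_nth (residual 0 F) k = - (\<Sum>i=0..k. kernel i (k - i) * a i * a (k - i))
      + (m * a k + lam * (if k = 0 then 0 else (real k - 1) * a (k - 1)) + m * (real k * a k))"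
  proof -
    have "fps_nth (fps_X * T) k = (if k = 0 then 0 else (real k - 1) * a (k - 1))"
      by (cases k) (simp_all add: T_def a_def)
    moreover have "(\<Sum>i=0..k. kernel i (k - i) * a i * a (k - i)) =
        m * fps_nth (F * F) k + fps_nth (T * T) k - 2 * fps_nth (F * E) k"
      unfolding fps_mult_nth sum_distrib_left sum.distrib[symmetric] sum_subtractf[symmetric]
      by (rule sum.cong) (simp_all add: kernel_def T_def E_def a_def algebra_simps)
    moreover have "fps_nth T k = real k * a k"
      by (simp add: T_def a_def)
    ultimately show ?thesis
      unfolding res fps_add_nth fps_sub_nth fps_mult_left_const_nth a_def by simp
  qed
  also have "\<dots> = (if k = 0 then 0 else
    (real k - 1) * (2 * real k + m) * a k
    - (\<Sum>i\<in>{1..<k}. kernel i (k - i) * a i * a (k - i)) + lam * (real k - 1) * a (k - 1))"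
  proof (cases "k = 0")
    case False
    \<comment> \<open>The end terms i = 0 and i = k contain the unknown \<open>a k\<close>. With
      \<open>a 0 = 1\<close> they combine with the linear terms to (k - 1) (2 k + m). At k = 0 the
      two ends coincide, hence the case split.\<close>
    have "{0..k} = insert 0 (insert k {1..<k})"
      using False by auto
    then have "(\<Sum>i=0..k. kernel i (k - i) * a i * a (k - i)) =
        kernel 0 k * a k + (kernel k 0 * a k + (\<Sum>i\<in>{1..<k}. kernel i (k - i) * a i * a (k - i)))"
      using False assms(2) by simp
    then show ?thesis
      using False by (simp add: kernel_def algebra_simps)
  next
    case True
    with assms(2) show ?thesis
      by (simp add: kernel_def)
  qed
  finally show ?thesis .
qed

text \<open>Formal uniqueness at the singular point: for k \<ge> 2 the factor of the k-th
  coefficient is nonzero and all other terms have lower index.\<close>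

lemma eq_origin_coeff_if_residual_0:
  assumes "fps_nth F 0 = 1" "fps_nth F 1 = mu" "residual 0 F = 0"
  shows "fps_nth F k = origin_coeff mu k"
proof (induction k rule: less_induct)
  case (less k)
  consider "k = 0" | "k = 1" | "k \<ge> 2" by linarith
  then show ?case
  proof cases
    case 3
    have "(\<Sum>i\<in>{1..<k}. kernel i (k - i) * fps_nth F i * fps_nth F (k - i)) =
      (\<Sum>i\<in>{1..<k}. kernel i (k - i) * origin_coeff mu i * origin_coeff mu (k - i))"
      by (rule sum.cong) (simp_all add: less)
    moreover have "fps_nth F (k - 1) = origin_coeff mu (k - 1)"
      using 3 by (intro less) simp
    ultimately have "(real k - 1) * (2 * real k + m) * fps_nth F k =
        (real k - 1) * (2 * real k + m) * origin_coeff mu k"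
      using 3 residual_0_nth[OF assms(1), of k] assms(3) origin_coeff_ge_2[OF 3, of mu] by simp
    moreover have "(real k - 1) * (2 * real k + m) \<noteq> 0"
      using 3 m_ge_1 by auto
    ultimately show ?thesis
      by (simp only: mult_cancel_left) simp
  qed (use assms(1,2) in simp_all)
qed

lemma residual_0_origin_coeff: "residual 0 (Abs_fps (origin_coeff mu)) = 0"
proof (rule fps_ext)
  fix k
  let ?F = "Abs_fps (origin_coeff mu)"
  have 0: "fps_nth ?F 0 = 1"
    by simp
  show "fps_nth (residual 0 ?F) k = fps_nth 0 k"
  proof (cases "k \<ge> 2")
    case True
    then show ?thesis
      using residual_0_nth[OF 0, of k] origin_coeff_ge_2[OF True, of mu] by simp
  next
    case False
    \<comment> \<open>At k = 1 the sum is empty and both remaining terms carry the factor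
      \<open>real k - 1\<close>, so no condition arises.\<close>
    then have "k = 0 \<or> k = 1" by auto
    then show ?thesis
      using residual_0_nth[OF 0, of k] by auto
  qed
qed

text \<open>The divisor \<open>?P\<close> is at least k^2 + m. It therefore dominates
  \<open>kernel\<close> up to the factor 4, and also k - 1, so dividing by it leaves constants
  independent of k.\<close>

lemma origin_coeff_step:
  assumes "k \<ge> 2"
  shows "\<bar>origin_coeff mu k\<bar> \<le>
    4 * (\<Sum>i\<in>{1..<k}. \<bar>origin_coeff mu i\<bar> * \<bar>origin_coeff mu (k - i)\<bar>) + lam * \<bar>origin_coeff mu (k - 1)\<bar>"
proof -
  let ?a = "\<lambda>i. origin_coeff mu i" and ?P = "(real k - 1) * (2 * real k + m)"
  have k: "real k \<ge> 2" using assms by simp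
  have "(real k)\<^sup>2 \<le> (real k - 1) * (2 * real k)"
    using k mult_left_mono[of 2 "real k" "real k"] by (simp add: algebra_simps power2_eq_square)
  moreover have "m \<le> (real k - 1) * m"
    using k m_ge_1 by simp
  ultimately have P: "(real k)\<^sup>2 + m \<le> ?P"
    by (simp add: algebra_simps)
  have kern: "\<bar>kernel i (k - i)\<bar> \<le> 4 * ?P" if i: "i \<in> {1..<k}" for i
  proof -
    define p q where "p = real i" and "q = real (k - i)"
    have pq: "real k = p + q" "p \<ge> 1" "q \<ge> 1"
      using i by (auto simp: p_def q_def)
    have "q * (q - 1) \<le> (real k)\<^sup>2" "p * q \<le> (real k)\<^sup>2"
      using pq by (auto simp: power2_eq_square intro!: mult_mono)
    moreover have "q * (q - 1) \<ge> 0" "p * q \<ge> 0" using pq by auto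
    moreover have "kernel i (k - i) = m + p * q - 2 * (q * (q - 1))"
      by (simp add: kernel_def p_def q_def)
    ultimately show ?thesis
      using P m_ge_1 by linarith
  qed
  have Ppos: "?P > 0"
    using P m_ge_1 by (smt (verit) zero_le_power2)
  have "\<bar>\<Sum>i\<in>{1..<k}. kernel i (k - i) * ?a i * ?a (k - i)\<bar>
      \<le> (\<Sum>i\<in>{1..<k}. 4 * ?P * (\<bar>?a i\<bar> * \<bar>?a (k - i)\<bar>))"
    by (rule order_trans[OF sum_abs], rule sum_mono)
      (unfold abs_mult mult.assoc[of "\<bar>kernel _ _\<bar>"], rule mult_right_mono[OF kern], simp_all)
  then have 1: "\<bar>\<Sum>i\<in>{1..<k}. kernel i (k - i) * ?a i * ?a (k - i)\<bar>
      \<le> ?P * (4 * (\<Sum>i\<in>{1..<k}. \<bar>?a i\<bar> * \<bar>?a (k - i)\<bar>))"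
    by (simp only: sum_distrib_left mult_ac)
  have "real k - 1 \<le> ?P"
    using mult_left_mono[of 1 "2 * real k + m" "real k - 1"] k m_ge_1 by simp
  then have "(real k - 1) * (lam * \<bar>?a (k - 1)\<bar>) \<le> ?P * (lam * \<bar>?a (k - 1)\<bar>)"
    using lam_nonneg by (intro mult_right_mono) auto
  then have 2: "\<bar>lam * (real k - 1) * ?a (k - 1)\<bar> \<le> ?P * (lam * \<bar>?a (k - 1)\<bar>)"
    using k lam_nonneg by (simp add: abs_mult mult_ac)
  have "\<bar>?a k\<bar> * ?P = \<bar>?a k * ?P\<bar>"
    using Ppos by (subst abs_mult) (simp only: abs_of_pos)
  also have "?a k * ?P = (\<Sum>i\<in>{1..<k}. kernel i (k - i) * ?a i * ?a (k - i)) - lam * (real k - 1) * ?a (k - 1)"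
    using origin_coeff_ge_2[OF assms, of mu] by (simp only: mult.commute)
  also have "\<bar>\<dots>\<bar> \<le> ?P * (4 * (\<Sum>i\<in>{1..<k}. \<bar>?a i\<bar> * \<bar>?a (k - i)\<bar>)) + ?P * (lam * \<bar>?a (k - 1)\<bar>)"
    using 1 2 by linarith
  finally have "?P * \<bar>?a k\<bar> \<le> ?P * (4 * (\<Sum>i\<in>{1..<k}. \<bar>?a i\<bar> * \<bar>?a (k - i)\<bar>) + lam * \<bar>?a (k - 1)\<bar>)"
    by (simp add: distrib_left mult.commute)
  then show ?thesis
    using Ppos by (rule mult_left_le_imp_le)
qed

lemma conv_radius_origin: "fps_conv_radius (Abs_fps (origin_coeff mu)) > 0"
proof -
  \<comment> \<open>The base case k = 1 needs B \<ge> 256 |mu|, because the bound there is B / 256.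
    The term 8 lam serves the linear part of the recursion. In the step, the quadratic part gives 4
    / 512 = 1 / 128 and the linear part another 1 / 128, together 1 / 64.\<close>
  define B where "B = 8 * lam + 256 * \<bar>mu\<bar> + 1"
  have B: "B \<ge> 1" using lam_nonneg by (simp add: B_def)
  have bound: "\<bar>origin_coeff mu k\<bar> \<le> 1 / 64 * (B ^ k / (real k + 1)\<^sup>2)" if "k \<ge> 1" for k
    using that
  proof (induction k rule: less_induct)
    case (less k)
    show ?case
    proof (cases "k = 1")
      case True
      then show ?thesis
        using lam_nonneg by (simp add: B_def)
    next
      case False
      with less have k: "k \<ge> 2" by simp
      \<comment> \<open>Index 0 is removed because the coefficient 1 violates the bound 1 / 64.
        Indices from \<open>k\<close> on are removed so that the induction hypothesis covers the
        rest. Coefficient \<open>k\<close> of \<open>G * G\<close> is still the full sum.\<close>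
      define G where "G = Abs_fps (\<lambda>i. if i = 0 \<or> i \<ge> k then 0 else \<bar>origin_coeff mu i\<bar>)"
      have "majorized (1 / 64) B k G"
        unfolding majorized_def using less.IH B by (auto simp: G_def)
      then have "majorized (8 * (1 / 64) * (1 / 64)) B k (G * G)"
        using B by (intro majorized_mult) auto
      then have "\<bar>fps_nth (G * G) k\<bar> \<le> 1 / 512 * (B ^ k / (real k + 1)\<^sup>2)"
        unfolding majorized_def by auto
      moreover have "fps_nth (G * G) k = (\<Sum>i\<in>{1..<k}. \<bar>origin_coeff mu i\<bar> * \<bar>origin_coeff mu (k - i)\<bar>)"
        unfolding fps_mult_nth by (rule sum.mono_neutral_cong_right) (auto simp: G_def)
      ultimately have 1: "(\<Sum>i\<in>{1..<k}. \<bar>origin_coeff mu i\<bar> * \<bar>origin_coeff mu (k - i)\<bar>)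
          \<le> 1 / 512 * (B ^ k / (real k + 1)\<^sup>2)"
        by linarith
      have "lam * \<bar>origin_coeff mu (k - 1)\<bar> \<le> lam * (1 / 64 * (B ^ (k - 1) / (real k)\<^sup>2))"
        using less.IH[of "k - 1"] k lam_nonneg by (intro mult_left_mono) (auto simp: of_nat_diff)
      also have "\<dots> \<le> (B / 8) * (1 / 64 * (B ^ (k - 1) * (4 / (real k + 1)\<^sup>2)))"
      proof -
        have "(real k + 1)\<^sup>2 \<le> (2 * real k)\<^sup>2"
          using k by (intro power_mono) auto
        then have "1 / (real k)\<^sup>2 \<le> 4 / (real k + 1)\<^sup>2"
          using k by (simp add: field_simps)
        then have "B ^ (k - 1) * (1 / (real k)\<^sup>2) \<le> B ^ (k - 1) * (4 / (real k + 1)\<^sup>2)"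
          using B by (intro mult_left_mono) auto
        then show ?thesis
          using B lam_nonneg by (intro mult_mono) (auto simp: B_def)
      qed
      also have "\<dots> = 1 / 128 * (B ^ k / (real k + 1)\<^sup>2)"
        using k by (simp add: power_eq_if)
      finally show ?thesis
        using origin_coeff_step[OF k, of mu] 1 by linarith
    qed
  qed
  have "\<bar>fps_nth (Abs_fps (origin_coeff mu)) k\<bar> \<le> 1 * B ^ k" for k
  proof (cases "k = 0")
    case False
    have "1 \<le> (real k + 1)\<^sup>2" by (intro one_le_power) simp
    then have "1 / 64 * (B ^ k / (real k + 1)\<^sup>2) \<le> 1 * (B ^ k / 1)"
      using B by (intro mult_mono frac_le) auto
    then show ?thesis
      using bound[of k] False by simp
  qed simp
  from fps_conv_radius_ge_if_geometric[OF _ this] B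
  have "ereal (1 / B) \<le> fps_conv_radius (Abs_fps (origin_coeff mu))"
    by simp
  moreover have "ereal (1 / B) > 0" using B by simp
  ultimately show ?thesis by (rule order.strict_trans2[rotated])
qed

section \<open>Expansions at regular points\<close>

text \<open>Formal division by R^2 F. The factor \<open>1\<close> in the \<open>lam\<close> term
  keeps it a product of three series, the shape required by \<open>majorized_mult3\<close>.\<close>

lemma second_deriv_eq:
  assumes "residual c F = 0" "fps_nth F 0 \<noteq> 0" "c \<noteq> 0"
  defines "Y \<equiv> fps_deriv F" and "Z \<equiv> inverse F" and "P \<equiv> inverse (fps_const c + fps_X)"
  shows "fps_const 2 * fps_deriv Y = fps_const m * ((F - 1) * P * P) + Y * Y * Z
    - fps_const lam * (Y * Z * 1) - fps_const m * (Y * Z * P)"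
proof -
  define R where "R = fps_const c + fps_X"
  define l k where "l = fps_const lam" and "k = fps_const m"
  have RP: "R * P = 1"
    unfolding R_def P_def using assms(3) by (intro inverse_mult_eq_1') auto
  have FZ: "F * Z = 1"
    unfolding Z_def using assms(2) by (intro inverse_mult_eq_1')
  have eq: "fps_const 2 * (R * R) * F * fps_deriv Y = k * F * (F - 1) + R * Y * (R * Y - l * R - k)"
    using assms(1) by (simp add: residual_def Let_def R_def Y_def l_def k_def)
  have "fps_const 2 * fps_deriv Y = fps_const 2 * fps_deriv Y * (R * P) * (R * P) * (F * Z)"
    by (simp add: RP FZ)
  also have "\<dots> = (fps_const 2 * (R * R) * F * fps_deriv Y) * (P * P * Z)"
    by (simp only: mult_ac)
  also have "\<dots> = k * (F - 1) * P * P * (F * Z) + (R * P) * (R * P) * Y * Y * Z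
      - l * (Y * Z) * (R * P) * (R * P) - k * (Y * Z * P) * (R * P)"
    unfolding eq by (simp add: algebra_simps)
  finally show ?thesis
    unfolding RP FZ by (simp add: l_def k_def mult.assoc)
qed

text \<open>Chosen so that 4 N = M B in \<open>majorized_deriv\<close>, where B is this rate and N =
  64 (3 m + 1 + lam) M^3 collects the cubic terms of the system, each majorized by 64 M^3 times its
  coefficient.\<close>

definition growth_rate :: "real \<Rightarrow> real" where
  "growth_rate M = 256 * (3 * m + 1 + lam) * M\<^sup>2"

lemma growth_rate_pos: "M \<ge> 1 \<Longrightarrow> growth_rate M > 0"
  using lam_nonneg m_ge_1 by (simp add: growth_rate_def)

text \<open>
  With \<open>Z = 1 / F\<close> and \<open>P = 1 / r\<close> the equation becomes a first-order system for
  \<open>(F, F', Z, P)\<close> with cubic right-hand side, so one majorant propagates through the recursion.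
\<close>

lemma majorized_regular:
  assumes "residual c F = 0" "c > 0" "fps_nth F 0 > 0" "M \<ge> 1"
    and "fps_nth F 0 \<le> M" "\<bar>fps_nth F 1\<bar> \<le> M" "1 / fps_nth F 0 \<le> M" "1 / c \<le> M"
  shows "majorized M (growth_rate M) K F \<and> majorized M (growth_rate M) K (inverse F)"
proof -
  define Y Z P B where "Y = fps_deriv F" and "Z = inverse F"
    and "P = inverse (fps_const c + fps_X)" and "B = growth_rate M"
  define L where "L = 3 * m + 1 + lam"
  have L: "L \<ge> 1" using lam_nonneg m_ge_1 by (simp add: L_def)
  have B: "B \<ge> 0" using growth_rate_pos[of M] assms(4) by (simp add: B_def)
  define N where "N = 64 * L * M ^ 3"
  have BN: "4 * N \<le> M * B"
    by (simp add: N_def B_def growth_rate_def L_def power3_eq_cube power2_eq_square algebra_simps)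
  have M3: "M \<le> M ^ 3" "1 \<le> M ^ 3"
    using assms(4) power_increasing[of 1 3 M] by simp_all
  have MN: "M ^ 3 * 64 \<le> N"
  proof -
    have "1 * M ^ 3 \<le> L * M ^ 3"
      by (rule mult_right_mono[OF L]) (use M3 in linarith)
    then show ?thesis by (simp add: N_def)
  qed
  have dZ: "fps_deriv Z = - (Y * Z * Z)"
    unfolding Z_def Y_def using assms(3) by (simp add: fps_inverse_deriv power2_eq_square mult.assoc)
  have dP: "fps_deriv P = - (P * P * 1)"
    unfolding P_def using assms(2) by (simp add: fps_inverse_deriv power2_eq_square)
  have dY: "fps_const 2 * fps_deriv Y = fps_const m * ((F - 1) * P * P) + Y * Y * Z
      - fps_const lam * (Y * Z * 1) - fps_const m * (Y * Z * P)"
    unfolding Y_def Z_def P_def using assms by (intro second_deriv_eq) auto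
  have "majorized M B K F \<and> majorized M B K Y \<and> majorized M B K Z \<and> majorized M B K P"
  proof (induction K)
    case 0
    then show ?case
      using assms by (simp add: majorized_0_iff Y_def Z_def P_def inverse_eq_divide)
  next
    case (Suc K)
    then have IH: "majorized M B K F" "majorized M B K Y" "majorized M B K Z" "majorized M B K P"
      by auto
    have one: "majorized M B K 1"
      using majorized_1[OF B] assms(4) B by (rule majorized_mono)
    note mult3 = majorized_mult3[where M = M, OF _ _ _ B]
    have FPP: "majorized (2 * (64 * M ^ 3)) B K ((F - 1) * P * P)"
    proof -
      \<comment> \<open>Split so that every factor is majorized by \<open>M\<close> itself; this is
        the source of the 2 in the bound.\<close>
      have "(F - 1) * P * P = F * P * P - 1 * P * P"
        by (simp add: algebra_simps)
      moreover have "majorized (64 * M ^ 3 + 64 * M ^ 3) B K (F * P * P - 1 * P * P)"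
        using IH one assms(4) by (intro majorized_diff mult3) auto
      ultimately show ?thesis by simp
    qed
    have "majorized (\<bar>m\<bar> * (2 * (64 * M ^ 3)) + 64 * M ^ 3 + \<bar>lam\<bar> * (64 * M ^ 3) + \<bar>m\<bar> * (64 * M ^ 3)) B K
        (fps_const 2 * fps_deriv Y)"
      unfolding dY using IH one assms(4) FPP
      by (intro majorized_diff majorized_add majorized_cmult mult3) auto
    from majorized_cmult[OF this, of "1 / 2"]
    have "majorized (1 / 2 * (\<bar>m\<bar> * (2 * (64 * M ^ 3)) + 64 * M ^ 3 + \<bar>lam\<bar> * (64 * M ^ 3) + \<bar>m\<bar> * (64 * M ^ 3))) B K
        (fps_deriv Y)"
      by (simp add: mult.assoc[symmetric])
    moreover have "\<bar>m\<bar> * (2 * (64 * M ^ 3)) + 64 * M ^ 3 + \<bar>lam\<bar> * (64 * M ^ 3) + \<bar>m\<bar> * (64 * M ^ 3) = N"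
      using lam_nonneg m_ge_1 by (simp add: N_def L_def algebra_simps)
    ultimately have "majorized (1 / 2 * N) B K (fps_deriv Y)"
      by simp
    then have Y': "majorized N B K (fps_deriv Y)"
      by (rule majorized_mono) (use MN M3 B in auto)
    have Z': "majorized N B K (fps_deriv Z)"
      unfolding dZ using IH assms(4) MN B
      by (intro majorized_uminus majorized_mono[OF mult3]) auto
    have P': "majorized N B K (fps_deriv P)"
      unfolding dP using IH one assms(4) MN B
      by (intro majorized_uminus majorized_mono[OF mult3]) auto
    have F': "majorized N B K (fps_deriv F)"
      using IH(2) MN M3 B unfolding Y_def by (auto intro: majorized_mono)
    show ?case
      using majorized_deriv[OF IH(1) F' BN B] majorized_deriv[OF IH(2) Y' BN B]
        majorized_deriv[OF IH(3) Z' BN B] majorized_deriv[OF IH(4) P' BN B] by simp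
  qed
  then show ?thesis
    by (simp add: B_def Z_def)
qed

text \<open>The step length depends only on \<open>M\<close>. Positivity persists because
  \<open>inverse F\<close> converges on the same interval, so F * inverse F = 1 forbids a zero
  there.\<close>

lemma regular_extension:
  assumes "residual c F = 0" "c > 0" "fps_nth F 0 > 0" "M \<ge> 1"
    and "fps_nth F 0 \<le> M" "\<bar>fps_nth F 1\<bar> \<le> M" "1 / fps_nth F 0 \<le> M" "1 / c \<le> M"
    and s: "0 \<le> s" "s < 1 / growth_rate M"
  shows "ereal s < fps_conv_radius F" "eval_fps F s > 0"
proof -
  have rad: "fps_conv_radius F \<ge> ereal (1 / growth_rate M)"
    "fps_conv_radius (inverse F) \<ge> ereal (1 / growth_rate M)"
    using assms majorized_regular[OF assms(1-8)] growth_rate_pos[OF assms(4)]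
    by (auto intro!: fps_conv_radius_ge_if_majorized[where M = M])
  have less: "ereal \<bar>t\<bar> < fps_conv_radius F" "ereal \<bar>t\<bar> < fps_conv_radius (inverse F)"
    if "0 \<le> t" "t \<le> s" for t
    using that s by (auto intro: order.strict_trans2[OF _ rad(1)] order.strict_trans2[OF _ rad(2)])
  show "ereal s < fps_conv_radius F"
    using less(1)[of s] s by simp
  show "eval_fps F s > 0"
  proof (rule ccontr)
    assume "\<not> eval_fps F s > 0"
    moreover have "continuous_on {0..s} (eval_fps F)"
      using less by (intro continuous_at_imp_continuous_on ballI continuous_eval_fps) auto
    ultimately obtain t where t: "0 \<le> t" "t \<le> s" "eval_fps F t = 0"
      using IVT2'[of "eval_fps F" s 0 0] s assms(3) by (auto simp: eval_fps_at_0)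
    have "F * inverse F = 1"
      using assms(3) by (intro inverse_mult_eq_1') auto
    then have "eval_fps F t * eval_fps (inverse F) t = 1"
      using less[of t] t eval_fps_mult[of t F "inverse F"] by simp
    with t show False by simp
  qed
qed

section \<open>A priori bounds\<close>

lemma solves_at_iff_of_eventually_eq:
  assumes "power_series_at f c F" "\<forall>\<^sub>F x in nhds c. f x = g x"
  shows "solves_at g c \<longleftrightarrow> solves_at f c"
proof -
  have "solves_at h c \<longleftrightarrow> eval_fps (residual c F) (c - c) = 0" if "power_series_at h c F" for h
    using that by (intro solves_at_iff_residual) (auto simp: power_series_at_def zero_ereal_def)
  then show ?thesis
    using assms power_series_at_cong by blast
qed

section \<open>Solutions on an initial interval\<close>

abbreviation origin_series :: "real \<Rightarrow> real fps" where
  "origin_series mu \<equiv> Abs_fps (origin_coeff mu)"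

text \<open>The initial data are encoded as agreement with the origin series on some interval whose
  length is not tied to \<open>R\<close>. All other conditions are pointwise in \<open>c\<close>,
  which makes restriction and passage to suprema immediate.\<close>

definition solution_on :: "real \<Rightarrow> real \<Rightarrow> (real \<Rightarrow> real) \<Rightarrow> bool" where
  "solution_on mu R f \<longleftrightarrow>
     (\<exists>e>0. \<forall>x\<in>{0..<e}. f x = eval_fps (origin_series mu) x) \<and>
     (\<forall>c. 0 < c \<and> c < R \<longrightarrow> (\<exists>F. power_series_at f c F) \<and> solves_at f c \<and> f c > 0)"

lemma solution_on_regular:
  assumes "solution_on mu R f" "0 < c" "c < R"
  shows "\<exists>F. power_series_at f c F \<and> residual c F = 0 \<and> fps_nth F 0 = f c \<and> fps_nth F 1 = deriv f c"
    and "solves_at f c" "f c > 0" "(f has_real_derivative deriv f c) (at c)"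
    and "(deriv f has_real_derivative deriv (deriv f) c) (at c)"
proof -
  show "solves_at f c" "f c > 0"
    using assms unfolding solution_on_def by blast+
  obtain F where F: "power_series_at f c F"
    using assms unfolding solution_on_def by blast
  have "\<forall>\<^sub>F x in nhds c. f x = eval_fps F (x - c)" "fps_conv_radius F > 0"
    using F by (auto simp: power_series_at_def)
  then have "\<forall>\<^sub>F x in at_right c. f x = eval_fps F (x - c)"
    by (simp add: eventually_nhds_conv_at eventually_at_split)
  moreover have "\<forall>\<^sub>F r in at_right c. solves_at f r"
    unfolding eventually_at_right[OF assms(3)]
    using assms unfolding solution_on_def by (intro exI[of _ R]) auto
  ultimately have "residual c F = 0"
    using \<open>fps_conv_radius F > 0\<close> by (intro residual_eq_0) auto
  moreover have "fps_nth F 1 = deriv f c"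
    using power_series_at_deriv(3)[OF power_series_at_deriv(1)[OF F]] by simp
  moreover have "fps_nth F 0 = f c"
    using power_series_at_deriv(3)[OF F] by simp
  ultimately show "\<exists>F. power_series_at f c F \<and> residual c F = 0 \<and> fps_nth F 0 = f c \<and> fps_nth F 1 = deriv f c"
    using F by blast
  show "(f has_real_derivative deriv f c) (at c)"
    "(deriv f has_real_derivative deriv (deriv f) c) (at c)"
    by (rule power_series_at_deriv(2)[OF F], rule power_series_at_deriv(2)[OF power_series_at_deriv(1)[OF F]])
qed

text \<open>Only one-sided statements are possible, as values of \<open>f\<close> at negative
  arguments are unconstrained.\<close>

lemma solution_on_near_0:
  assumes "solution_on mu R f"
  shows "f 0 = 1" "continuous (at 0 within {0..}) f" "(deriv f \<longlongrightarrow> mu) (at_right 0)"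
proof -
  define G0 where "G0 = origin_series mu"
  have orig: "fps_nth G0 0 = 1" "fps_nth G0 1 = mu" "fps_conv_radius G0 > 0"
    by (simp_all add: G0_def conv_radius_origin)
  obtain e where e: "e > 0" "\<And>x. 0 \<le> x \<Longrightarrow> x < e \<Longrightarrow> f x = eval_fps G0 x"
    using assms by (auto simp: solution_on_def G0_def)
  show "f 0 = 1"
    using e orig by (simp add: eval_fps_at_0)
  have cont: "continuous (at 0 within A) (eval_fps G)" if "fps_conv_radius G > 0" for G :: "real fps" and A
    using that by (intro continuous_eval_fps) (simp add: zero_ereal_def)
  show "continuous (at 0 within {0..}) f"
    by (rule continuous_transform_within[OF cont[OF orig(3)] e(1)]) (use e in \<open>auto simp: dist_real_def\<close>)
  have "continuous (at_right 0) (eval_fps (fps_deriv G0))"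
    by (rule cont[OF less_fps_conv_radius_deriv[OF orig(3)]])
  then have "(eval_fps (fps_deriv G0) \<longlongrightarrow> mu) (at_right 0)"
    using orig(2) by (simp add: continuous_within eval_fps_at_0)
  moreover obtain r where r: "r > 0" "ereal r < fps_conv_radius G0"
    using orig(3) ereal_dense2[of 0 "fps_conv_radius G0"] by (auto simp: zero_ereal_def)
  have "deriv f x = eval_fps (fps_deriv G0) x" if x: "0 < x" "x < min e r" for x
  proof -
    have "\<forall>\<^sub>F y in nhds x. y \<in> {0<..<e}"
      using x by (intro eventually_nhds_in_open) auto
    then have ev: "\<forall>\<^sub>F y in nhds x. f y = eval_fps G0 (y - 0)"
      by eventually_elim (use e in auto)
    have rad: "ereal \<bar>x - 0\<bar> < fps_conv_radius G0"
      using x r by (auto intro: order.strict_trans[of _ "ereal r"])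
    show ?thesis
      using DERIV_imp_deriv[OF eventually_nhds_x_imp_x[OF eventually_deriv_eval_fps[OF ev rad]]] by simp
  qed
  then have "\<forall>\<^sub>F x in at_right 0. eval_fps (fps_deriv G0) x = deriv f x"
    unfolding eventually_at_right[OF zero_less_one]
    using e r by (intro exI[of _ "min e r"]) auto
  ultimately show "(deriv f \<longlongrightarrow> mu) (at_right 0)"
    by (rule Lim_transform_eventually)
qed

lemma solution_on_continuous:
  assumes "solution_on mu R f" "t < R"
  shows "continuous_on {0..t} f"
  unfolding continuous_on_eq_continuous_within
proof
  fix x assume x: "x \<in> {0..t}"
  show "continuous (at x within {0..t}) f"
  proof (cases "x = 0")
    case True
    have "continuous (at 0 within {0..t}) f"
      by (rule continuous_within_subset[OF solution_on_near_0(2)[OF assms(1)]]) (rule subsetI, simp)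
    with True show ?thesis by simp
  next
    case False
    with x assms(2) have "0 < x" "x < R" by simp_all
    then have "(f has_real_derivative deriv f x) (at x)"
      by (rule solution_on_regular(4)[OF assms(1)])
    then show ?thesis
      by (rule DERIV_isCont[THEN continuous_at_imp_continuous_at_within])
  qed
qed

lemma solution_on_mvt:
  assumes "solution_on mu R f" "0 < t" "t < R"
  obtains z where "0 < z" "z < t" "f t - 1 = t * deriv f z"
proof -
  have D: "(f has_real_derivative deriv f x) (at x)" if "0 < x" "x < t" for x
    using that assms(3) by (intro solution_on_regular[OF assms(1)]) auto
  then have diff: "f differentiable (at x)" if "0 < x" "x < t" for x
    using that real_differentiable_def by blast
  obtain l z where z: "0 < z" "z < t" "(f has_real_derivative l) (at z)" "f t - f 0 = (t - 0) * l"
    using MVT[OF assms(2) solution_on_continuous[OF assms(1,3)] diff] by blast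
  moreover have "l = deriv f z"
    using z(3) by (simp add: DERIV_imp_deriv)
  ultimately show thesis
    using that[of z] solution_on_near_0(1)[OF assms(1)] by simp
qed

text \<open>Multiplication by \<open>mu\<close> treats both signs at once. At a first zero t of h_r
  the equation reduces to 2 t^2 h_rr = m (h - 1), so mu h_r would increase strictly through 0 at t
  and be negative just before it, contrary to the choice of t.\<close>

lemma solution_on_monotone:
  assumes sol: "solution_on mu R f" and "mu \<noteq> 0" and r: "0 < r" "r < R"
  shows "mu * deriv f r > 0" "mu * (f r - 1) > 0"
proof -
  have "mu * mu > 0"
    using \<open>mu \<noteq> 0\<close> by (metis not_real_square_gt_zero)
  moreover have "((\<lambda>x. mu * deriv f x) \<longlongrightarrow> mu * mu) (at_right 0)"
    by (intro tendsto_intros solution_on_near_0(3)[OF sol])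
  ultimately have "\<forall>\<^sub>F x in at_right 0. mu * deriv f x > 0"
    by (intro order_tendstoD(1))
  then obtain e where e: "e > 0" "\<And>x. 0 < x \<Longrightarrow> x < e \<Longrightarrow> mu * deriv f x > 0"
    unfolding eventually_at_right[OF zero_less_one] by auto
  have cont: "isCont (\<lambda>x. mu * deriv f x) x" if "0 < x" "x < R" for x
    using solution_on_regular(5)[OF sol that] by (intro continuous_mult_left DERIV_isCont)
  have pos: "mu * deriv f x > 0" if x: "0 < x" "x < R" for x
  proof (rule ccontr)
    assume neg: "\<not> mu * deriv f x > 0"
    define T where "T = {e/2..x} \<inter> (\<lambda>x. mu * deriv f x) -` {..0}"
    have "x \<in> T"
      using neg e(2)[of x] x e(1) by (cases "x < e") (auto simp: T_def)
    moreover have "closed T"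
      unfolding T_def using x e(1)
      by (intro continuous_closed_preimage continuous_at_imp_continuous_on ballI cont) auto
    moreover have bdd: "bdd_below T"
      by (auto simp: T_def intro: bdd_belowI[of _ "e/2"])
    ultimately have InfT: "Inf T \<in> T"
      using closed_contains_Inf by blast
    define t where "t = Inf T"
    have t: "e / 2 \<le> t" "t \<le> x" "mu * deriv f t \<le> 0"
      using InfT by (auto simp: T_def t_def)
    have "0 < t" "t < R"
      using t x e(1) by auto
    have before: "mu * deriv f y > 0" if y: "0 < y" "y < t" for y
    proof (cases "y < e")
      case False
      have "y \<notin> T"
        using y(2) cInf_lower[OF _ bdd] unfolding t_def by force
      then show ?thesis
        using False y t e(1) by (auto simp: T_def)
    qed (use e(2) y in auto)
    have "mu * deriv f t \<ge> 0"
    proof (rule tendsto_lowerbound)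
      show "((\<lambda>x. mu * deriv f x) \<longlongrightarrow> mu * deriv f t) (at_left t)"
        using cont[OF \<open>0 < t\<close> \<open>t < R\<close>] unfolding isCont_def by (rule tendsto_within_subset[OF _ subset_UNIV])
      show "\<forall>\<^sub>F x in at_left t. 0 \<le> mu * deriv f x"
        unfolding eventually_at_left[OF \<open>0 < t\<close>]
        using before \<open>0 < t\<close> by (intro exI[of _ 0]) (auto intro: less_imp_le)
    qed simp
    then have f't: "deriv f t = 0"
      using t(3) \<open>mu \<noteq> 0\<close> by simp
    obtain z where z: "0 < z" "z < t" "f t - 1 = t * deriv f z"
      using solution_on_mvt[OF sol \<open>0 < t\<close> \<open>t < R\<close>] by blast
    have ft: "mu * (f t - 1) > 0"
      using before[OF z(1,2)] \<open>0 < t\<close> unfolding z(3) mult.left_commute[of mu] by (rule mult_pos_pos[rotated])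
    have *: "f t > 0" "solves_at f t" "(deriv f has_real_derivative deriv (deriv f) t) (at t)"
      by (rule solution_on_regular[OF sol \<open>0 < t\<close> \<open>t < R\<close>])+
    have "f t * (2 * t\<^sup>2 * deriv (deriv f) t) = f t * (m * (f t - 1))"
      using *(2) f't by (simp add: solves_at_def mult_ac)
    then have "2 * t\<^sup>2 * deriv (deriv f) t = m * (f t - 1)"
      using *(1) by simp
    then have "2 * t\<^sup>2 * (mu * deriv (deriv f) t) = m * (mu * (f t - 1))"
      by (simp only: mult.left_commute)
    also have "\<dots> > 0"
      using ft m_ge_1 by simp
    finally have "mu * deriv (deriv f) t > 0"
      by (simp add: zero_less_mult_iff)
    moreover have "((\<lambda>x. mu * deriv f x) has_real_derivative mu * deriv (deriv f) t) (at t)"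
      using *(3) by (rule DERIV_cmult)
    ultimately obtain d where d: "d > 0" "\<And>h. 0 < h \<Longrightarrow> h < d \<Longrightarrow> mu * deriv f (t - h) < mu * deriv f t"
      using DERIV_pos_inc_left by blast
    define h where "h = min (d / 2) (t / 2)"
    have "0 < h" "h < d" "h < t"
      using d(1) \<open>0 < t\<close> by (auto simp: h_def)
    then show False
      using d(2)[of h] before[of "t - h"] f't by simp
  qed
  show "mu * deriv f r > 0"
    using pos r by blast
  obtain z where z: "0 < z" "z < r" "f r - 1 = r * deriv f z"
    using solution_on_mvt[OF sol r] by blast
  then show "mu * (f r - 1) > 0"
    using r z pos unfolding z(3) mult.left_commute[of mu] by (intro mult_pos_pos[OF r(1)] pos) auto
qed

text \<open>Monotonicity of \<open>W\<close> bounds r h_r / h by \<open>V\<close>. Integrating the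
  logarithmic derivative bounds h by \<open>A\<close>, and the two bounds together control h_r.
  Since h > 1, nothing is needed for 1 / h beyond the bound 1.\<close>

lemma solution_on_bounded_increasing:
  assumes sol: "solution_on mu R f" and "mu > 0" and r0: "0 < r0"
  shows "\<exists>M. \<forall>r. r0 \<le> r \<and> r < R \<longrightarrow> f r \<le> M \<and> \<bar>deriv f r\<bar> \<le> M \<and> 1 / f r \<le> M"
proof -
  define W where "W r = r * deriv f r / f r - (m + 1) / 2 * ln r" for r
  define V where "V = \<bar>W r0\<bar> + (m + 1) / 2 * \<bar>ln R\<bar>"
  define A where "A = exp (\<bar>ln (f r0)\<bar> + V / r0 * R)"
  have pos: "deriv f r > 0" "f r > 1" if "0 < r" "r < R" for r
    using solution_on_monotone[OF sol _ that] \<open>mu > 0\<close> by (auto simp: zero_less_mult_iff)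
  have W: "W r \<le> W r0" if r: "r0 \<le> r" "r < R" for r
  proof (rule DERIV_nonpos_imp_nonincreasing[OF r(1)])
    fix x assume x: "r0 \<le> x" "x \<le> r"
    then have xR: "0 < x" "x < R" using r r0 by auto
    note reg = solution_on_regular[OF sol xR]
    define a b d where "a = f x" and "b = deriv f x" and "d = deriv (deriv f) x"
    have ab: "a > 0" "b > 0" using pos[OF xR] by (auto simp: a_def b_def)
    have "(W has_real_derivative
        ((1 * b + d * x) * a - (x * b) * b) / (a * a) - (m + 1) / 2 * (1 / x)) (at x)"
      unfolding W_def a_def b_def d_def
      using reg(3) xR by (auto intro!: derivative_eq_intros reg(4,5) simp: field_simps)
    moreover have "((1 * b + d * x) * a - (x * b) * b) / (a * a) - (m + 1) / 2 * (1 / x) \<le> 0"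
    proof -
      have ode: "2 * x\<^sup>2 * a * d = m * a * (a - 1) + x * b * (x * b - lam * x - m)"
        using reg(2) by (simp add: solves_at_def a_def b_def d_def)
      \<comment> \<open>The factor 2 x produces the second-order term of the equation. The
        coefficient (m + 1) / 2 in \<open>W\<close> cancels m a^2 and supplies the a^2 that
        completes the square.\<close>
      have "2 * x * (((1 * b + d * x) * a - (x * b) * b) - (m + 1) * (a * a) / (2 * x))
          = 2 * x * a * b + 2 * x\<^sup>2 * a * d - 2 * (x * b)\<^sup>2 - (m + 1) * a\<^sup>2"
        using xR by (simp add: field_simps power2_eq_square)
      also have "\<dots> = - (x * b - a)\<^sup>2 - m * a - lam * x\<^sup>2 * b - m * x * b"
        unfolding ode by (simp add: algebra_simps power2_eq_square)
      also have "\<dots> \<le> 0"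
      proof -
        have "m * a \<ge> 0" "lam * x\<^sup>2 * b \<ge> 0" "m * x * b \<ge> 0" "(x * b - a)\<^sup>2 \<ge> 0"
          using ab xR lam_nonneg m_ge_1 by simp_all
        then show ?thesis by linarith
      qed
      finally have "((1 * b + d * x) * a - (x * b) * b) - (m + 1) * (a * a) / (2 * x) \<le> 0"
        using xR by (simp add: mult_le_0_iff)
      then have "(((1 * b + d * x) * a - (x * b) * b) - (m + 1) * (a * a) / (2 * x)) / (a * a) \<le> 0"
        using ab by (simp add: divide_le_0_iff)
      then show ?thesis
        using ab by (simp add: diff_divide_distrib)
    qed
    ultimately show "\<exists>y. (W has_real_derivative y) (at x) \<and> y \<le> 0" by blast
  qed
  have v: "r * deriv f r / f r \<le> V" if r: "r0 \<le> r" "r < R" for r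
  proof -
    have "ln r \<le> \<bar>ln R\<bar>"
      using r r0 ln_le_cancel_iff[of r R] by linarith
    then have "(m + 1) / 2 * ln r \<le> (m + 1) / 2 * \<bar>ln R\<bar>"
      using m_ge_1 by (intro mult_left_mono) auto
    then show ?thesis
      using W[OF r] unfolding V_def W_def[of r] by linarith
  qed
  have V: "V \<ge> 0"
    using m_ge_1 by (simp add: V_def)
  have fA: "f r \<le> A" if r: "r0 \<le> r" "r < R" for r
  proof -
    \<comment> \<open>A Gronwall argument: the derivative of ln h is at most V / x, hence at most V
      / r0.\<close>
    have "ln (f r) - V / r0 * r \<le> ln (f r0) - V / r0 * r0"
    proof (rule DERIV_nonpos_imp_nonincreasing[OF r(1)])
      fix x assume x: "r0 \<le> x" "x \<le> r"
      then have xR: "0 < x" "x < R" using r r0 by auto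
      note reg = solution_on_regular[OF sol xR]
      have "((\<lambda>r. ln (f r) - V / r0 * r) has_real_derivative deriv f x / f x - V / r0) (at x)"
        using reg(3) r0 by (auto intro!: derivative_eq_intros reg(4))
      moreover have "deriv f x / f x \<le> V / x"
        using v[of x] x r xR by (simp add: field_simps)
      moreover have "V / x \<le> V / r0"
        using x V r0 by (intro divide_left_mono) auto
      ultimately show "\<exists>y. ((\<lambda>r. ln (f r) - V / r0 * r) has_real_derivative y) (at x) \<and> y \<le> 0"
        by (intro exI[of _ "deriv f x / f x - V / r0"]) auto
    qed
    moreover have "V / r0 * r \<le> V / r0 * R"
      using V r0 r by (intro mult_left_mono) auto
    moreover have "V / r0 * r0 \<ge> 0"
      using V r0 by simp
    ultimately have "ln (f r) \<le> \<bar>ln (f r0)\<bar> + V / r0 * R"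
      by linarith
    then have "exp (ln (f r)) \<le> A"
      by (simp add: A_def)
    then show ?thesis
      using pos(2)[of r] r r0 by simp
  qed
  have "\<bar>deriv f r\<bar> \<le> V * A / r0" if r: "r0 \<le> r" "r < R" for r
  proof -
    have rR: "0 < r" using r r0 by auto
    have "r0 * deriv f r \<le> r * deriv f r"
      using r pos(1)[OF rR] by (intro mult_right_mono) auto
    also have "\<dots> \<le> V * f r"
      using v[OF r] pos(2)[OF rR] r by (simp add: field_simps)
    also have "\<dots> \<le> V * A"
      using fA[OF r] V by (rule mult_left_mono)
    finally show ?thesis
      using r0 pos(1)[OF rR] r by (simp add: field_simps)
  qed
  moreover have "1 / f r \<le> 1" if "r0 \<le> r" "r < R" for r
    using pos(2)[of r] that r0 by simp
  ultimately show ?thesis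
    using fA by (intro exI[of _ "max 1 (max A (V * A / r0))"]) (auto simp: le_max_iff_disj)
qed

text \<open>
  \<open>E\<close> below plays the role of a Lyapunov function: its logarithmic term keeps \<open>f\<close> away from zero,
  and here the sign of \<open>lam\<close> is essential.
\<close>

lemma solution_on_bounded_decreasing:
  assumes sol: "solution_on mu R f" and "mu < 0" and r0: "0 < r0"
  shows "\<exists>M. \<forall>r. r0 \<le> r \<and> r < R \<longrightarrow> f r \<le> M \<and> \<bar>deriv f r\<bar> \<le> M \<and> 1 / f r \<le> M"
proof -
  define E where "E r = f r - r * deriv f r - m / 2 * ln (f r) - m / 2 * ln r" for r
  define K where "K = \<bar>E r0\<bar> + m / 2 * \<bar>ln R\<bar>"
  have sgn: "deriv f r < 0" "f r < 1" "f r > 0" if "0 < r" "r < R" for r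
    using solution_on_monotone[OF sol _ that] solution_on_regular(3)[OF sol that] \<open>mu < 0\<close>
    by (auto simp: zero_less_mult_iff)
  have E: "E r \<le> E r0" if r: "r0 \<le> r" "r < R" for r
  proof (rule DERIV_nonpos_imp_nonincreasing[OF r(1)])
    fix x assume x: "r0 \<le> x" "x \<le> r"
    then have xR: "0 < x" "x < R" using r r0 by auto
    note reg = solution_on_regular[OF sol xR]
    define a b d where "a = f x" and "b = deriv f x" and "d = deriv (deriv f) x"
    have ab: "a > 0" "b < 0" using sgn[OF xR] by (auto simp: a_def b_def)
    have "(E has_real_derivative b - (1 * b + d * x) - m / 2 * (b / a) - m / 2 * (1 / x)) (at x)"
      unfolding E_def a_def b_def d_def
      using reg(3) xR by (auto intro!: derivative_eq_intros reg(4,5) simp: field_simps)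
    moreover have "b - (1 * b + d * x) - m / 2 * (b / a) - m / 2 * (1 / x) \<le> 0"
    proof -
      have ode: "2 * x\<^sup>2 * a * d = m * a * (a - 1) + x * b * (x * b - lam * x - m)"
        using reg(2) by (simp add: solves_at_def a_def b_def d_def)
      \<comment> \<open>The positive factor 2 x a brings in the equation. The term from ln h cancels
        m x b, and the term from ln r cancels the linear part m a.\<close>
      have "(2 * x * a) * (b - (1 * b + d * x) - m / 2 * (b / a) - m / 2 * (1 / x))
          = - (2 * x\<^sup>2 * a * d) - m * x * b - m * a"
        using xR ab by (simp add: field_simps power2_eq_square)
      also have "\<dots> = - (m * a\<^sup>2) - (x * b)\<^sup>2 + lam * x\<^sup>2 * b"
        unfolding ode by (simp add: algebra_simps power2_eq_square)
      also have "\<dots> \<le> 0"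
      proof -
        have "lam * x\<^sup>2 * b \<le> 0"
          using lam_nonneg ab by (simp add: mult_nonneg_nonpos)
        moreover have "m * a\<^sup>2 \<ge> 0"
          using m_ge_1 by simp
        moreover have "(x * b)\<^sup>2 \<ge> 0" by simp
        ultimately show ?thesis by linarith
      qed
      finally show ?thesis
        using xR ab by (simp add: mult_le_0_iff)
    qed
    ultimately show "\<exists>y. (E has_real_derivative y) (at x) \<and> y \<le> 0" by blast
  qed
  have bound: "- r * deriv f r \<le> K" "- ln (f r) \<le> 2 / m * K" if r: "r0 \<le> r" "r < R" for r
  proof -
    have rR: "0 < r" "r < R" using r r0 by auto
    have "ln r \<le> \<bar>ln R\<bar>"
      using r r0 ln_le_cancel_iff[of r R] by linarith
    then have "m / 2 * ln r \<le> m / 2 * \<bar>ln R\<bar>"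
      using m_ge_1 by (intro mult_left_mono) auto
    then have *: "f r - r * deriv f r - m / 2 * ln (f r) \<le> K"
      using E[OF r] unfolding K_def E_def[of r] by linarith
    \<comment> \<open>All three summands on the left of \<open>*\<close> are nonnegative, so
      \<open>K\<close> bounds each of them.\<close>
    have "r * deriv f r \<le> 0" "m / 2 * ln (f r) \<le> 0" "f r > 0"
      using sgn[OF rR] rR m_ge_1 by (auto simp: mult_le_0_iff)
    with * have "- r * deriv f r \<le> K" "- (m / 2 * ln (f r)) \<le> K"
      by auto
    then show "- r * deriv f r \<le> K" "- ln (f r) \<le> 2 / m * K"
      using m_ge_1 by (auto simp: field_simps)
  qed
  have "1 / f r \<le> exp (2 / m * K)" if r: "r0 \<le> r" "r < R" for r
  proof -
    have "exp (- ln (f r)) \<le> exp (2 / m * K)"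
      using bound(2)[OF r] by simp
    then show ?thesis
      using sgn(3)[of r] r r0 by (simp add: exp_minus inverse_eq_divide)
  qed
  moreover have "\<bar>deriv f r\<bar> \<le> K / r0" if r: "r0 \<le> r" "r < R" for r
  proof -
    have "r0 * (- deriv f r) \<le> r * (- deriv f r)"
      using r sgn(1)[of r] r0 by (intro mult_right_mono) auto
    also have "\<dots> \<le> K"
      using bound(1)[OF r] by simp
    finally show ?thesis
      using sgn(1)[of r] r r0 by (simp add: field_simps)
  qed
  moreover have "f r \<le> 1" if "r0 \<le> r" "r < R" for r
    using sgn(2)[of r] that r0 by simp
  ultimately show ?thesis
    by (intro exI[of _ "max 1 (max (exp (2 / m * K)) (K / r0))"]) (auto simp: le_max_iff_disj)
qed

section \<open>Continuation\<close>

text \<open>The bounds near \<open>R\<close> are uniform, so the guaranteed radius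
  \<open>\<rho>\<close> is the same for all centres in the upper half of the interval, and one close
  to \<open>R\<close> reaches beyond it.\<close>

lemma solution_on_extend:
  assumes sol: "solution_on mu R f" and "mu \<noteq> 0" and "R > 0"
  shows "\<exists>\<delta>>0. \<exists>g. solution_on mu (R + \<delta>) g"
proof -
  have "\<exists>M. \<forall>r. R / 2 \<le> r \<and> r < R \<longrightarrow> f r \<le> M \<and> \<bar>deriv f r\<bar> \<le> M \<and> 1 / f r \<le> M"
  proof (cases "mu > 0")
    case True
    then show ?thesis
      using \<open>R > 0\<close> by (intro solution_on_bounded_increasing[OF sol]) auto
  next
    case False
    then show ?thesis
      using assms by (intro solution_on_bounded_decreasing[OF sol]) auto
  qed
  then obtain M0 where M0: "\<And>r. R / 2 \<le> r \<Longrightarrow> r < R \<Longrightarrow> f r \<le> M0 \<and> \<bar>deriv f r\<bar> \<le> M0 \<and> 1 / f r \<le> M0"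
    by blast
  define M where "M = max (max 1 M0) (2 / R)"
  define \<rho> where "\<rho> = 1 / growth_rate M"
  have M: "M \<ge> 1" "M \<ge> M0" "M \<ge> 2 / R" by (auto simp: M_def)
  have \<rho>: "\<rho> > 0" using growth_rate_pos[OF M(1)] by (simp add: \<rho>_def)
  \<comment> \<open>The first term keeps \<open>c\<close> where the bounds hold and gives 1 / c
    \<le> 2 / R; the second places \<open>R\<close> within \<open>\<rho> / 2\<close> of
    \<open>c\<close>.\<close>
  define c where "c = max (R / 2) (R - \<rho> / 2)"
  have c: "R / 2 \<le> c" "0 < c" "c < R" "R < c + \<rho>"
    using \<open>R > 0\<close> \<rho> by (auto simp: c_def)
  obtain F where F: "power_series_at f c F" "residual c F = 0" "fps_nth F 0 = f c" "fps_nth F 1 = deriv f c"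
    using solution_on_regular(1)[OF sol c(2,3)] by blast
  have "1 / c \<le> 2 / R"
    using c \<open>R > 0\<close> by (simp add: field_simps)
  then have ext: "ereal s < fps_conv_radius F" "eval_fps F s > 0" if "0 \<le> s" "s < \<rho>" for s
    using regular_extension[OF F(2) c(2) _ M(1)] that F(3,4) M0[OF c(1,3)] M
      solution_on_regular(3)[OF sol c(2,3)] unfolding \<rho>_def by auto
  define g where "g x = (if x < c then f x else eval_fps F (x - c))" for x
  have "solution_on mu (c + \<rho>) g"
    unfolding solution_on_def
  proof (intro conjI allI impI)
    obtain e where "e > 0" "\<forall>x\<in>{0..<e}. f x = eval_fps (origin_series mu) x"
      using sol by (auto simp: solution_on_def)
    then show "\<exists>e>0. \<forall>x\<in>{0..<e}. g x = eval_fps (origin_series mu) x"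
      using c by (intro exI[of _ "min e c"]) (auto simp: g_def)
  next
    fix d assume d: "0 < d \<and> d < c + \<rho>"
    have "(\<exists>F. power_series_at g d F) \<and> solves_at g d \<and> g d > 0"
    proof (cases "d < c")
      case True
      then have dR: "0 < d" "d < R" using d c by auto
      have "\<forall>\<^sub>F x in nhds d. x \<in> {..<c}"
        using True by (intro eventually_nhds_in_open) auto
      then have ev: "\<forall>\<^sub>F x in nhds d. f x = g x"
        by eventually_elim (auto simp: g_def)
      obtain G where G: "power_series_at f d G"
        using solution_on_regular(1)[OF sol dR] by blast
      have "g d = f d"
        using True by (simp add: g_def)
      then show ?thesis
        using power_series_at_cong[OF G ev] solves_at_iff_of_eventually_eq[OF G ev]
          solution_on_regular(2,3)[OF sol dR] by auto
    next
      case False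
      \<comment> \<open>At d = c the two pieces fit because \<open>F\<close> also represents
        \<open>f\<close> to the left of \<open>c\<close>.\<close>
      have ev: "\<forall>\<^sub>F x in nhds d. g x = eval_fps F (x - c)"
      proof (cases "d = c")
        case True
        have "\<forall>\<^sub>F x in nhds c. f x = eval_fps F (x - c)"
          using F(1) by (simp add: power_series_at_def)
        then show ?thesis
          unfolding True by eventually_elim (simp add: g_def)
      next
        case d_ne: False
        have "\<forall>\<^sub>F x in nhds d. x \<in> {c<..}"
          using False d_ne by (intro eventually_nhds_in_open) auto
        then show ?thesis
          by eventually_elim (simp add: g_def)
      qed
      have rad: "ereal \<bar>d - c\<bar> < fps_conv_radius F"
        using ext(1)[of "d - c"] False d by simp
      have "g d > 0"
        using ext(2)[of "d - c"] False d by (simp add: g_def)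
      then show ?thesis
        using power_series_at_recenter[OF ev rad] solves_at_iff_residual[OF ev rad] F(2) by simp
    qed
    then show "\<exists>F. power_series_at g d F" "solves_at g d" "g d > 0" by blast+
  qed
  then show ?thesis
    using c(4) by (intro exI[of _ "c + \<rho> - R"]) auto
qed

section \<open>Uniqueness and gluing\<close>

text \<open>Let t be the infimum of the points of disagreement. It is positive because both
  functions follow the origin series. Agreement to the left of t makes the two expansions at t
  equal, so agreement continues past t.\<close>

lemma solution_on_unique:
  assumes f: "solution_on mu R f" and g: "solution_on mu R g" and x: "0 \<le> x" "x < R"
  shows "f x = g x"
proof (rule ccontr)
  assume "f x \<noteq> g x"
  define T where "T = {y. 0 \<le> y \<and> f y \<noteq> g y}"
  define t where "t = Inf T"
  have bdd: "bdd_below T"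
    by (rule bdd_belowI[of _ 0]) (simp add: T_def)
  have "x \<in> T"
    using x \<open>f x \<noteq> g x\<close> by (simp add: T_def)
  have agree: "f y = g y" if "0 \<le> y" "y < t" for y
    using cInf_lower[OF _ bdd, of y] that by (auto simp: T_def t_def)
  obtain e1 where e1: "e1 > 0" "\<forall>x\<in>{0..<e1}. f x = eval_fps (origin_series mu) x"
    using f by (auto simp: solution_on_def)
  obtain e2 where e2: "e2 > 0" "\<forall>x\<in>{0..<e2}. g x = eval_fps (origin_series mu) x"
    using g by (auto simp: solution_on_def)
  have "min e1 e2 \<le> t"
    unfolding t_def
  proof (rule cInf_greatest)
    show "T \<noteq> {}"
      using \<open>x \<in> T\<close> by blast
    fix y assume "y \<in> T"
    then have "0 \<le> y" "f y \<noteq> g y"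
      by (simp_all add: T_def)
    then show "min e1 e2 \<le> y"
      using e1(2) e2(2) by (cases "y < e1"; cases "y < e2") auto
  qed
  then have "t > 0"
    using e1(1) e2(1) by linarith
  have "t \<le> x"
    unfolding t_def using \<open>x \<in> T\<close> bdd by (rule cInf_lower)
  then have "t < R"
    using x(2) by simp
  obtain F where F: "power_series_at f t F"
    using solution_on_regular(1)[OF f \<open>t > 0\<close> \<open>t < R\<close>] by blast
  obtain G where G: "power_series_at g t G"
    using solution_on_regular(1)[OF g \<open>t > 0\<close> \<open>t < R\<close>] by blast
  have evF: "\<forall>\<^sub>F y in nhds t. f y = eval_fps F (y - t)" and evG: "\<forall>\<^sub>F y in nhds t. g y = eval_fps G (y - t)"
    using F G by (simp_all add: power_series_at_def)
  have "\<forall>\<^sub>F y in nhds t. y > 0"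
    using eventually_nhds_in_open[of "{0<..}" t] \<open>t > 0\<close> by simp
  with evF evG have "\<forall>\<^sub>F y in nhds t. y < t \<longrightarrow> eval_fps F (y - t) = eval_fps G (y - t)"
    by eventually_elim (use agree in force)
  moreover have "nhds 0 = filtermap (\<lambda>y. y - t) (nhds t)"
    by (simp add: filtermap_nhds_shift)
  ultimately have "\<forall>\<^sub>F s in nhds 0. s < 0 \<longrightarrow> eval_fps F s = eval_fps G s"
    by (simp add: eventually_filtermap)
  then have "\<forall>\<^sub>F s in at_left 0. eval_fps F s = eval_fps G s"
    unfolding eventually_at_filter by eventually_elim simp
  then have "F = G"
    using F G unfolding power_series_at_def
    by (intro fps_eq_if_frequently_0 frequently_at_if_eventually_at_left) auto
  have "\<forall>\<^sub>F y in nhds t. f y = g y"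
    using evF evG by eventually_elim (simp add: \<open>F = G\<close>)
  then obtain d where d: "d > 0" "\<And>y. \<bar>y - t\<bar> < d \<Longrightarrow> f y = g y"
    by (auto simp: eventually_nhds_metric dist_real_def)
  have "t + d \<le> Inf T"
  proof (rule cInf_greatest)
    show "T \<noteq> {}"
      using \<open>x \<in> T\<close> by blast
    fix y assume "y \<in> T"
    then have y: "0 \<le> y" "f y \<noteq> g y"
      by (simp_all add: T_def)
    with agree have "t \<le> y"
      using not_less by blast
    with y(2) d(2)[of y] show "t + d \<le> y"
      by (cases "y < t + d") auto
  qed
  then show False
    using d(1) by (simp add: t_def)
qed

lemma solution_on_cong:
  assumes f: "solution_on mu R f" and "R > 0" and eq: "\<And>x. 0 \<le> x \<Longrightarrow> x < R \<Longrightarrow> f x = g x"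
  shows "solution_on mu R g"
  unfolding solution_on_def
proof (intro conjI allI impI)
  obtain e where "e > 0" "\<And>x. 0 \<le> x \<Longrightarrow> x < e \<Longrightarrow> f x = eval_fps (origin_series mu) x"
    using f by (auto simp: solution_on_def)
  then show "\<exists>e>0. \<forall>x\<in>{0..<e}. g x = eval_fps (origin_series mu) x"
    using \<open>R > 0\<close> by (intro exI[of _ "min e R"]) (simp flip: eq)
next
  fix c assume "0 < c \<and> c < R"
  then have c: "0 < c" "c < R" by auto
  have "\<forall>\<^sub>F x in nhds c. x \<in> {0<..<R}"
    using c by (intro eventually_nhds_in_open) auto
  then have ev: "\<forall>\<^sub>F x in nhds c. f x = g x"
    by eventually_elim (use eq in auto)
  obtain F where F: "power_series_at f c F"
    using solution_on_regular(1)[OF f c] by blast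
  show "\<exists>F. power_series_at g c F"
    using power_series_at_cong[OF F ev] by blast
  show "solves_at g c"
    using solves_at_iff_of_eventually_eq[OF F ev] solution_on_regular(2)[OF f c] by blast
  show "g c > 0"
    using solution_on_regular(3)[OF f c] eq[of c] c by simp
qed

lemma solution_on_mono: "solution_on mu R f \<Longrightarrow> R' \<le> R \<Longrightarrow> solution_on mu R' f"
  by (auto simp: solution_on_def)

lemma solution_on_origin: "\<exists>R>0. solution_on mu R (eval_fps (origin_series mu))"
proof -
  define F where "F = origin_series mu"
  have rad: "fps_conv_radius F > 0"
    by (simp add: F_def conv_radius_origin)
  obtain r where r: "r > 0" "ereal r < fps_conv_radius F"
    using rad ereal_dense2[of 0 "fps_conv_radius F"] by (auto simp: zero_ereal_def)
  have "isCont (eval_fps F) 0"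
    using rad by (intro continuous_eval_fps) (simp add: zero_ereal_def)
  then have "(eval_fps F \<longlongrightarrow> 1) (at 0)"
    by (simp add: isCont_def eval_fps_at_0 F_def)
  then have "\<forall>\<^sub>F x in at 0. eval_fps F x > 0"
    by (rule order_tendstoD(1)) simp
  then obtain d where d: "d > 0" "\<And>x. x \<noteq> 0 \<Longrightarrow> \<bar>x\<bar> < d \<Longrightarrow> eval_fps F x > 0"
    by (auto simp: eventually_at dist_real_def)
  have "solution_on mu (min r d) (eval_fps F)"
    unfolding solution_on_def
  proof (intro conjI allI impI)
    show "\<exists>e>0. \<forall>x\<in>{0..<e}. eval_fps F x = eval_fps (origin_series mu) x"
      by (intro exI[of _ 1]) (simp add: F_def)
    fix c assume c: "0 < c \<and> c < min r d"
    have ev: "\<forall>\<^sub>F x in nhds c. eval_fps F x = eval_fps F (x - 0)"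
      by simp
    have "ereal c < fps_conv_radius F"
      using c by (intro order.strict_trans[OF _ r(2)]) simp
    then have c_rad: "ereal \<bar>c - 0\<bar> < fps_conv_radius F"
      using c by simp
    show "\<exists>F'. power_series_at (eval_fps F) c F'"
      by (rule power_series_at_recenter[OF ev c_rad])
    show "solves_at (eval_fps F) c"
      using solves_at_iff_residual[OF ev c_rad] by (simp add: F_def residual_0_origin_coeff)
    show "eval_fps F c > 0"
      using d(2) c by simp
  qed
  then show ?thesis
    using r(1) d(1) unfolding F_def by (intro exI[of _ "min r d"]) auto
qed

text \<open>Settles \<open>mu = 0\<close>, which the sign argument excludes: the series 1 has zero
  residual and so is the origin series.\<close>

lemma solution_on_1: "solution_on 0 R (\<lambda>_. 1)"
proof -
  have "residual 0 1 = 0"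
    by (simp add: residual_def)
  then have "origin_coeff 0 = fps_nth 1"
    using eq_origin_coeff_if_residual_0[of 1 0] by auto
  then have *: "origin_series 0 = 1"
    by (simp add: fps_nth_inverse)
  show ?thesis
    unfolding solution_on_def *
  proof (intro conjI allI impI)
    show "\<exists>e>0. \<forall>x\<in>{0..<e}. 1 = eval_fps 1 (x::real)"
      by (intro exI[of _ 1]) simp
    fix c :: real
    show "\<exists>F. power_series_at (\<lambda>_. 1) c F"
      by (intro exI[of _ 1]) (simp add: power_series_at_def)
    show "solves_at (\<lambda>_. 1) c"
      by (simp add: solves_at_def)
  qed simp
qed

text \<open>All local solutions are glued, and the lengths reached are unbounded: a finite supremum
  would itself be reached and could then be exceeded by \<open>solution_on_extend\<close>.\<close>

theorem global_solution_exists: "\<exists>h. \<forall>R. solution_on mu R h"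
proof (cases "mu = 0")
  case True
  then show ?thesis
    using solution_on_1 by blast
next
  case False
  \<comment> \<open>By uniqueness the value does not depend on the chosen local solution; this is
    \<open>h_eq\<close>.\<close>
  define h where "h x = (SOME y. \<exists>R f. x < R \<and> solution_on mu R f \<and> y = f x)" for x
  have h_eq: "h x = f x" if f: "solution_on mu R f" and x: "0 \<le> x" "x < R" for R f x
  proof -
    have "\<exists>R f'. x < R \<and> solution_on mu R f' \<and> h x = f' x"
      unfolding h_def by (rule someI_ex) (use f x in blast)
    then obtain R' g where g: "x < R'" "solution_on mu R' g" "h x = g x"
      by blast
    have "g x = f x"
      using x g by (intro solution_on_unique[of mu "min R R'" g f] solution_on_mono[OF g(2)] solution_on_mono[OF f]) auto
    with g(3) show ?thesis by simp
  qed
  have h_sol: "solution_on mu R h" if "solution_on mu R f" "R > 0" for R f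
    using that h_eq[OF that(1)] by (intro solution_on_cong[of mu R f h]) auto
  obtain R0 f0 where R0: "R0 > 0" "solution_on mu R0 f0"
    using solution_on_origin by blast
  define S where "S = {R. 0 < R \<and> solution_on mu R h}"
  have "R0 \<in> S"
    using R0 h_sol by (simp add: S_def)
  have "\<not> bdd_above S"
  proof
    assume bdd: "bdd_above S"
    define s where "s = Sup S"
    have "R0 \<le> s"
      unfolding s_def using \<open>R0 \<in> S\<close> bdd by (rule cSup_upper)
    have "solution_on mu s h"
      unfolding solution_on_def
    proof (intro conjI allI impI)
      show "\<exists>e>0. \<forall>x\<in>{0..<e}. h x = eval_fps (origin_series mu) x"
        using \<open>R0 \<in> S\<close> by (simp add: S_def solution_on_def)
      fix c assume c: "0 < c \<and> c < s"
      then obtain R where R: "R \<in> S" "c < R"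
        using less_cSupD[of S c] \<open>R0 \<in> S\<close> unfolding s_def by blast
      then have "solution_on mu R h"
        by (simp add: S_def)
      then show "\<exists>F. power_series_at h c F" "solves_at h c" "h c > 0"
        using c R by (auto simp: solution_on_def)
    qed
    moreover have "s > 0"
      using \<open>R0 \<le> s\<close> R0(1) by simp
    ultimately obtain \<delta> g where "\<delta> > 0" "solution_on mu (s + \<delta>) g"
      using solution_on_extend False by blast
    then have "s + \<delta> \<in> S"
      using h_sol \<open>s > 0\<close> by (simp add: S_def)
    then have "s + \<delta> \<le> s"
      unfolding s_def using bdd by (rule cSup_upper)
    then show False
      using \<open>\<delta> > 0\<close> by simp
  qed
  then have "solution_on mu R h" for R
  proof -
    obtain R' where "R' \<in> S" "R \<le> R'"
      using \<open>\<not> bdd_above S\<close> unfolding bdd_above_def by (meson linear)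
    then show ?thesis
      by (auto simp: S_def intro: solution_on_mono)
  qed
  then show ?thesis by blast
qed

end

section \<open>Equivalence with the stated notion of solution\<close>

text \<open>From left to right, the expansion at 0 has zero residual and prescribed first two
  coefficients, which forces it to be the origin series. Neither side constrains \<open>h\<close> at
  negative arguments.\<close>

lemma is_solution_iff_solution_on:
  assumes "lam \<ge> 0" "n \<ge> 2"
  shows "is_solution lam mu n h \<longleftrightarrow> (\<forall>R. soliton_ode.solution_on lam (real n - 1) mu R h)"
proof -
  interpret soliton_ode lam "real n - 1"
    by unfold_locales (use assms in auto)
  define G0 where "G0 = origin_series mu"
  have rad0: "fps_conv_radius G0 > 0"
    by (simp add: G0_def conv_radius_origin)
  have D0: "(eval_fps G has_real_derivative fps_nth G 1) (at 0 within A)"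
    if "fps_conv_radius G > 0" for G :: "real fps" and A
    using has_field_derivative_eval_fps[of 0 G A] that by (simp add: eval_fps_at_0 zero_ereal_def)
  show ?thesis
  proof
    assume sol: "is_solution lam mu n h"
    then have an: "\<exists>a. \<exists>\<epsilon>>0. \<forall>x\<in>{0..}. \<bar>x - c\<bar> < \<epsilon> \<longrightarrow> (\<lambda>k. a k * (x - c) ^ k) sums h x" if "c \<in> {0..}" for c
      using that unfolding is_solution_def real_analytic_on_def by blast
    have ode: "solves_at h r" "h r > 0" if "r > 0" for r
      using sol that by (simp_all add: is_solution_def solves_at_def)
    obtain a \<epsilon> where a: "\<epsilon> > 0" "\<And>x. 0 \<le> x \<Longrightarrow> x < \<epsilon> \<Longrightarrow> (\<lambda>k. a k * x ^ k) sums h x"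
      using an[of 0] by auto
    define F where "F = Abs_fps a"
    have "ereal (norm (\<epsilon> / 2)) \<le> fps_conv_radius F"
      unfolding fps_conv_radius_def F_def using a(1)
      by (intro conv_radius_geI) (auto intro!: sums_summable[OF a(2)])
    then have rad: "fps_conv_radius F > 0"
      using a(1) by (auto simp: zero_ereal_def intro: order.strict_trans2[of _ "ereal (\<epsilon> / 2)"])
    have hF: "h x = eval_fps F x" if "0 \<le> x" "x < \<epsilon>" for x
      using sums_unique[OF a(2)[OF that]] by (simp add: eval_fps_def F_def)
    have F0: "fps_nth F 0 = 1"
      using hF[of 0] a(1) sol by (simp add: is_solution_def eval_fps_at_0)
    have "(h has_real_derivative fps_nth F 1) (at 0 within {0..})"
      by (rule has_field_derivative_transform_within[OF D0[OF rad] a(1)]) (use hF in \<open>auto simp: dist_real_def\<close>)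
    moreover have "(h has_real_derivative mu) (at 0 within {0..})"
      using sol by (simp add: is_solution_def)
    \<comment> \<open>Nontriviality of this filter makes the one-sided derivative unique, which
      identifies the linear coefficient with \<open>mu\<close>.\<close>
    moreover have "at_right 0 \<le> (at 0 within {0..} :: real filter)"
      by (rule at_le, rule subsetI) simp
    then have "at 0 within {0..} \<noteq> (bot :: real filter)"
      using trivial_limit_at_right_real[of "0 :: real"] le_bot by metis
    ultimately have F1: "fps_nth F 1 = mu"
      by (metis has_real_derivative_iff_has_vector_derivative vector_derivative_unique_within)
    have "residual 0 F = 0"
    proof (rule residual_eq_0[OF rad])
      show "\<forall>\<^sub>F r in at_right 0. h r = eval_fps F (r - 0)"
        using hF a(1) unfolding eventually_at_right[OF zero_less_one] by (intro exI[of _ \<epsilon>]) auto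
      show "\<forall>\<^sub>F r in at_right 0. solves_at h r"
        using ode(1) unfolding eventually_at_right[OF zero_less_one] by (intro exI[of _ 1]) auto
    qed
    then have "F = G0"
      unfolding G0_def by (intro fps_ext) (simp add: eq_origin_coeff_if_residual_0[OF F0 F1])
    show "\<forall>R. solution_on mu R h"
      unfolding solution_on_def
    proof (intro conjI allI impI)
      show "\<exists>e>0. \<forall>x\<in>{0..<e}. h x = eval_fps (origin_series mu) x"
        using hF a(1) \<open>F = G0\<close> by (intro exI[of _ \<epsilon>]) (simp add: G0_def)
      fix R c assume c: "0 < c \<and> c < (R::real)"
      then obtain b \<delta> where b: "\<delta> > 0" "\<And>x. x \<ge> 0 \<Longrightarrow> \<bar>x - c\<bar> < \<delta> \<Longrightarrow> (\<lambda>k. b k * (x - c) ^ k) sums h x"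
        using an[of c] by auto
      have "(\<lambda>s. h (c + s)) has_fps_expansion Abs_fps b"
        unfolding has_fps_expansion_iff_sums
      \<comment> \<open>The radius is cut at \<open>c\<close> because the given expansion is valid
        only at nonnegative arguments.\<close>
      proof (intro exI[of _ "min \<delta> c"] conjI allI impI)
        fix x assume x: "\<bar>x\<bar> < min \<delta> c"
        then have "0 \<le> c + x"
          by linarith
        with x show "(\<lambda>k. fps_nth (Abs_fps b) k * x ^ k) sums h (c + x)"
          using b(2)[of "c + x"] by simp
      qed (use b(1) c in auto)
      then show "\<exists>F. power_series_at h c F"
        by (auto simp: power_series_at_iff_has_fps_expansion)
      show "solves_at h c" "h c > 0"
        using ode c by auto
    qed
  next
    assume sol: "\<forall>R. solution_on mu R h"
    obtain e where e: "e > 0" "\<And>x. 0 \<le> x \<Longrightarrow> x < e \<Longrightarrow> h x = eval_fps G0 x"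
      using sol by (auto simp: solution_on_def G0_def)
    have reg: "\<exists>F. power_series_at h c F" "solves_at h c" "h c > 0" if "c > 0" for c
      using solution_on_regular(1-3)[of mu "c + 1" h c] sol that by auto
    have "real_analytic_on h {0..}"
      unfolding real_analytic_on_def
    proof
      fix c :: real assume c: "c \<in> {0..}"
      show "\<exists>a. \<exists>\<epsilon>>0. \<forall>x\<in>{0..}. \<bar>x - c\<bar> < \<epsilon> \<longrightarrow> (\<lambda>k. a k * (x - c) ^ k) sums h x"
      proof (cases "c = 0")
        case True
        have "eval_fps G0 has_fps_expansion G0"
          by (rule eval_fps_has_fps_expansion[OF rad0])
        then obtain d where d: "d > 0" "\<And>x. \<bar>x\<bar> < d \<Longrightarrow> (\<lambda>k. fps_nth G0 k * x ^ k) sums eval_fps G0 x"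
          by (auto simp: has_fps_expansion_iff_sums)
        show ?thesis
          using d e by (intro exI[of _ "fps_nth G0"] exI[of _ "min d e"]) (auto simp: True)
      next
        case False
        with c have "c > 0" by simp
        then obtain F where "(\<lambda>s. h (c + s)) has_fps_expansion F"
          using reg(1) by (auto simp: power_series_at_iff_has_fps_expansion)
        then obtain d where d: "d > 0" "\<And>x. \<bar>x\<bar> < d \<Longrightarrow> (\<lambda>k. fps_nth F k * x ^ k) sums h (c + x)"
          by (auto simp: has_fps_expansion_iff_sums)
        have "(\<lambda>k. fps_nth F k * (x - c) ^ k) sums h x" if "\<bar>x - c\<bar> < d" for x
          using d(2)[OF that] by simp
        then show ?thesis
          using d(1) by blast
      qed
    qed
    moreover have "h 0 = 1"
      using solution_on_near_0(1) sol by blast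
    moreover have "(h has_real_derivative mu) (at 0 within {0..})"
    proof -
      have "(h has_real_derivative fps_nth G0 1) (at 0 within {0..})"
        by (rule has_field_derivative_transform_within[OF D0[OF rad0] e(1)])
          (use e in \<open>auto simp: dist_real_def\<close>)
      then show ?thesis
        by (simp add: G0_def)
    qed
    ultimately show "is_solution lam mu n h"
      using reg(2,3) by (auto simp: is_solution_def solves_at_def)
  qed
qed

theorem theorem1p4:
  fixes lam \<mu>\<^sub>1 :: real and n :: nat
  assumes "lam \<ge> 0" and "n \<ge> 2"
  shows "\<exists>h. is_solution lam \<mu>\<^sub>1 n h \<and>
             (\<forall>g. is_solution lam \<mu>\<^sub>1 n g \<longrightarrow> (\<forall>r\<ge>0. g r = h r))"
proof -
  interpret soliton_ode lam "real n - 1"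
    by unfold_locales (use assms in auto)
  obtain h where h: "\<And>R. solution_on \<mu>\<^sub>1 R h"
    using global_solution_exists by blast
  have "g r = h r" if "is_solution lam \<mu>\<^sub>1 n g" "r \<ge> 0" for g r
  proof (rule solution_on_unique[OF _ h])
    show "solution_on \<mu>\<^sub>1 (r + 1) g"
      using that(1) is_solution_iff_solution_on[OF assms] by blast
  qed (use that(2) in auto)
  then show ?thesis
    using h is_solution_iff_solution_on[OF assms] by blast
qed

end
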